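(* Let $P$ be an increasing tableau, $(R,C)$ an outer cell of $P$, and $\alpha\in\{0,1\}$. Let $(P',m)$ be the output of reverse row insertion on $(P,(R,C),\alpha)$. If $\alpha=0$ then $K_-(P)=K_-(P')$. If $\alpha=1$ then $K_-(P)$ and $K_-(P')$ agree in every column except column $C$, where (as sets) $$K_-(P')_C=K_-(P)_C\setminus\{\min(K_-(P)_C\setminus K_-(P)_{C+1})\},$$ with $K_-(P)_{C+1}=\emptyset$ if $K_-(P)$ has no column $C+1$.
   Context: Tableaux are in English convention; $T(r,c)$ is the entry in row $r$, column $c$; $T_j$ is the set of entries in column $j$. An increasing tableau has positive integer entries strictly increasing along rows and columns. For finite $S,T\subseteq\mathbb{Z}_{>0}$, $T\triangleleft S$ is obtained by going through $S$ from largest to smallest, each $s$ picking the largest not-yet-picked element of $T$ less than $s$ (if any), and taking the picked set. The left key $K_-(P)$ of an increasing tableau $P$ is the tableau of the same shape whose column $j$ consists of $P_1\triangleleft(P_2\triangleleft(\cdots\triangleleft P_j))$ in increasing order. Reverse row insertion. $P_{r\downarrow}$ is $P$ with its first $r-1$ rows deleted. A value $x$ is ejectable in $P$ if $x$ is in the first row of $P$ and either $x+1$ is not in the first row, or $x+1$ is in the first row and is ejectable in $P_{2\downarrow}$. A cell $(r,c)$ is outer if neither $(r+1,c)$ nor $(r,c+1)$ is a cell. The bumping path of $(r,c)$ is $(r,c_r),\dots,(1,c_1)$ with $c_r=c$ and $c_i$ the largest index with $P(i,c_i)<P(i+1,c_{i+1})$; $m_i=P(i,c_i)$. Input: $P$,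 outer cell $(r,c)$, $\alpha\in\{0,1\}$; output $(P',m)$ with $m=m_1$. Start with $P'=P$. If $\alpha=1$, delete cell $(r,c)$ from $P'$, $\alpha_r=1$, $i=r-1$; if $\alpha=0$, $m_{r+1}=\infty$, $\alpha_{r+1}=0$, $i=r$. While $i\ge1$, with $R$ the set of entries of row $i$ of $P$: (D) if $m_i+1\in R$, leave row $i$, $\alpha_i=\alpha_{i+1}$; (DR) else if $\alpha_{i+1}=1$ and $m_{i+1}\notin R$, replace $m_i$ by $m_{i+1}$ in row $i$ of $P'$, $\alpha_i=1$; otherwise let $x$ be the largest value ejectable in the current $P'_{(i+1)\downarrow}$ with $m_i<x<m_{i+1}$: (IR) if it exists replace $m_i$ by $x$ in row $i$ of $P'$, $\alpha_i=1$; (NR) otherwise leave row $i$, $\alpha_i=0$. Decrease $i$ by one; at $i=0$ output $P'$ (an increasing tableau). *)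

theory Defs
  imports Main "HOL-Library.Extended_Nat"
begin

section \<open>Tableaux (English convention, 1-indexed cells)\<close>

text \<open>A tableau is a partial map from cells (row, column), both indices starting at 1,
  to entries. Its shape is its domain.\<close>

type_synonym tableau = "nat \<times> nat \<Rightarrow> nat option"

definition young_shape :: "(nat \<times> nat) set \<Rightarrow> bool" where
  "young_shape S \<longleftrightarrow> finite S \<and>
     (\<forall>r c. (r, c) \<in> S \<longrightarrow> 1 \<le> r \<and> 1 \<le> c \<and>
        (\<forall>r' c'. 1 \<le> r' \<and> r' \<le> r \<and> 1 \<le> c' \<and> c' \<le> c \<longrightarrow> (r', c') \<in> S))"

definition increasing_tableau :: "tableau \<Rightarrow> bool" where
  "increasing_tableau T \<longleftrightarrow> young_shape (dom T) \<and>
     (\<forall>x v. T x = Some v \<longrightarrow> 0 < v) \<and>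
     (\<forall>r c c' a b. c < c' \<and> T (r, c) = Some a \<and> T (r, c') = Some b \<longrightarrow> a < b) \<and>
     (\<forall>r r' c a b. r < r' \<and> T (r, c) = Some a \<and> T (r', c) = Some b \<longrightarrow> a < b)"

definition row_set :: "tableau \<Rightarrow> nat \<Rightarrow> nat set" where
  "row_set T i = {v. \<exists>c. T (i, c) = Some v}"

definition col_set :: "tableau \<Rightarrow> nat \<Rightarrow> nat set" where
  "col_set T j = {v. \<exists>r. T (r, j) = Some v}"

definition outer_cell :: "tableau \<Rightarrow> nat \<times> nat \<Rightarrow> bool" where
  "outer_cell T x \<longleftrightarrow> (case x of (r, c) \<Rightarrow>
     (r, c) \<in> dom T \<and> (r + 1, c) \<notin> dom T \<and> (r, c + 1) \<notin> dom T)"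

fun tri_aux :: "nat set \<Rightarrow> nat list \<Rightarrow> nat set \<Rightarrow> nat set" where
  "tri_aux T [] acc = acc"
| "tri_aux T (s # ss) acc =
     (let A = {t \<in> T. t < s \<and> t \<notin> acc}
      in tri_aux T ss (if A = {} then acc else insert (Max A) acc))"

definition tri :: "nat set \<Rightarrow> nat set \<Rightarrow> nat set" where
  "tri T S = tri_aux T (rev (sorted_list_of_set S)) {}"

fun nest :: "tableau \<Rightarrow> nat \<Rightarrow> nat \<Rightarrow> nat set" where
  "nest P i 0 = col_set P i"
| "nest P i (Suc k) = tri (col_set P i) (nest P (Suc i) k)"

definition key_col :: "tableau \<Rightarrow> nat \<Rightarrow> nat set" where
  "key_col P j = nest P 1 (j - 1)"

definition left_key :: "tableau \<Rightarrow> tableau" where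
  "left_key P = (\<lambda>(r, c). if (r, c) \<in> dom P
       then Some (sorted_list_of_set (key_col P c) ! (r - 1)) else None)"

text \<open>ejectable T k x: x is ejectable in T_{k\<down>} (T with its first k-1 rows deleted),
  whose first row is row k of T.\<close>
inductive ejectable :: "tableau \<Rightarrow> nat \<Rightarrow> nat \<Rightarrow> bool" where
  ej_base: "x \<in> row_set T k \<Longrightarrow> x + 1 \<notin> row_set T k \<Longrightarrow> ejectable T k x"
| ej_step: "x \<in> row_set T k \<Longrightarrow> x + 1 \<in> row_set T k \<Longrightarrow> ejectable T (k + 1) (x + 1)
            \<Longrightarrow> ejectable T k x"

text \<open>Bumping path of the cell (r,c): bcol P r c k is the column c_(r-k).\<close>
fun bcol :: "tableau \<Rightarrow> nat \<Rightarrow> nat \<Rightarrow> nat \<Rightarrow> nat" where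
  "bcol P r c 0 = c"
| "bcol P r c (Suc k) =
     (GREATEST j. \<exists>v. P (r - Suc k, j) = Some v \<and> v < the (P (r - k, bcol P r c k)))"

definition bm :: "tableau \<Rightarrow> nat \<Rightarrow> nat \<Rightarrow> nat \<Rightarrow> nat" where
  "bm P r c i = the (P (i, bcol P r c (r - i)))"

text \<open>One step at row i: Q is the current P', a = alpha_(i+1), mnext = m_(i+1)
  (infinity encoded as \<infinity>). Returns the new P' and alpha_i.\<close>
definition rri_step :: "tableau \<Rightarrow> tableau \<Rightarrow> nat \<Rightarrow> nat \<Rightarrow> nat \<Rightarrow> enat \<Rightarrow> bool
     \<Rightarrow> tableau \<times> bool" where
  "rri_step P Q i ci mi mnext a =
     (let R = row_set P i in
      if mi + 1 \<in> R then (Q, a)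
      else if a \<and> mnext \<notin> enat ` R then (Q((i, ci) := Some (the_enat mnext)), True)
      else (let X = {x. ejectable Q (i + 1) x \<and> mi < x \<and> enat x < mnext} in
            if X \<noteq> {} then (Q((i, ci) := Some (Max X)), True) else (Q, False)))"

fun rri_loop :: "tableau \<Rightarrow> nat \<Rightarrow> nat \<Rightarrow> nat \<Rightarrow> tableau \<times> bool \<Rightarrow> tableau \<times> bool" where
  "rri_loop P r c 0 st = st"
| "rri_loop P r c (Suc i) (Q, a) =
     rri_loop P r c i
       (rri_step P Q (Suc i) (bcol P r c (r - Suc i)) (bm P r c (Suc i))
          (if Suc i = r then \<infinity> else enat (bm P r c (Suc i + 1))) a)"

definition reverse_row_insertion :: "tableau \<Rightarrow> nat \<times> nat \<Rightarrow> nat \<Rightarrow> tableau \<times> nat" where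
  "reverse_row_insertion P x \<alpha> = (case x of (r, c) \<Rightarrow>
     (fst (if \<alpha> = 1 then rri_loop P r c (r - 1) (P((r, c) := None), True)
           else rri_loop P r c r (P, False)),
      bm P r c 1))"

end

theory Submission
  imports Defs
begin

text \<open>
  Read downwards in the values, \<open>tri T S\<close> is the departure process of a queue with arrivals \<open>S\<close> and
  services \<open>T\<close>, so the number of its elements \<open>\<ge> k\<close> is the minimum over \<open>l \<ge> k\<close> of
  \<open>|T \<inter> [k, l)| + |S \<inter> (l, \<infinity>)|\<close>. Iterating this, the number of elements \<open>\<ge> k\<close> of column \<open>n\<close> of the
  left key is the least cost of a lattice path that climbs from \<open>k\<close> to infinity while moving right from
  column \<open>1\<close> to column \<open>n\<close>, and pays for every tableau entry it meets in its current column.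

  Reverse row insertion changes entries along a path that climbs while moving left, so a lattice path
  feels the change in at most one column, and there only at the ends of its window. If it is more
  expensive in one of the two tableaux, then switching columns a little earlier or later, into the
  neighbouring column, removes the difference, because rows are increasing. The only exception is a
  path ending in column \<open>C\<close> when the cell \<open>(R, C)\<close> is deleted: it has no column to its right to escape
  to. Comparing with the paths that end in column \<open>C + 1\<close> shows that it becomes cheaper by one exactly
  for \<open>k \<le> Min (K\<^sub>C - K\<^sub>C\<^sub>+\<^sub>1)\<close>, where \<open>K\<^sub>j\<close> is column \<open>j\<close> of the key.
\<close>

section \<open>The queue formula\<close>

lemma card_Ico_split:
  fixes A :: "nat set"
  assumes "finite A" "k \<le> l"
  shows "card (A \<inter> {k..}) = card (A \<inter> {k..<l}) + card (A \<inter> {l..})"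
proof -
  have "A \<inter> {k..} = (A \<inter> {k..<l}) \<union> (A \<inter> {l..})" using assms(2) by auto
  then show ?thesis using assms(1)
    by (simp, subst card_Un_disjoint, auto)
qed

text \<open>The minimum formula for departures, split into an upper bound and its attainment, so
  that it can serve as an invariant for one arrival at a time. The value \<open>l\<close> is counted
  in neither set because a service lies strictly below its arrival.\<close>

definition queue_output :: "nat set \<Rightarrow> nat set \<Rightarrow> nat set \<Rightarrow> bool" where
  "queue_output T S D \<longleftrightarrow> D \<subseteq> T \<and>
     (\<forall>k l. k \<le> l \<longrightarrow> card (D \<inter> {k..}) \<le> card (T \<inter> {k..<l}) + card (S \<inter> {Suc l..})) \<and>
     (\<forall>k. \<exists>l\<ge>k. card (D \<inter> {k..}) = card (T \<inter> {k..<l}) + card (S \<inter> {Suc l..}))"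

lemma queue_output_empty: "finite T \<Longrightarrow> queue_output T {} {}"
  by (auto simp: queue_output_def)

text \<open>Arrivals come in decreasing order. The arrival \<open>s\<close> raises the right-hand
  side by one exactly for \<open>l < s\<close>, the service \<open>Max A\<close> raises the
  left-hand side by one exactly for \<open>k \<le> Max A\<close>, and these two changes have to
  match.\<close>

lemma queue_output_insert:
  assumes T: "finite T" and S: "finite S" and D: "queue_output T S D"
    and s: "\<And>x. x \<in> S \<Longrightarrow> s < x"
  defines "A \<equiv> {t \<in> T. t < s \<and> t \<notin> D}"
  shows "queue_output T (insert s S) (if A = {} then D else insert (Max A) D)"
proof -
  define D' where "D' = (if A = {} then D else insert (Max A) D)"
  have DT: "D \<subseteq> T" and ub: "\<And>k l. k \<le> l \<Longrightarrow> card (D \<inter> {k..}) \<le> card (T \<inter> {k..<l}) + card (S \<inter> {Suc l..})"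
    and ex: "\<And>k. \<exists>l\<ge>k. card (D \<inter> {k..}) = card (T \<inter> {k..<l}) + card (S \<inter> {Suc l..})"
    using D by (auto simp: queue_output_def)
  have fD: "finite D" using DT T finite_subset by blast
  have fA: "finite A" using T by (simp add: A_def)
  have sS: "s \<notin> S" using s by blast
  have Slow: "card (insert s S \<inter> {Suc l..}) = Suc (card (S \<inter> {Suc l..}))" if "l < s" for l
  proof -
    have "insert s S \<inter> {Suc l..} = insert s (S \<inter> {Suc l..})" using that by auto
    then show ?thesis using S sS by simp
  qed
  have Shigh: "insert s S \<inter> {Suc l..} = S \<inter> {Suc l..}" if "s \<le> l" for l
    using that by auto
  \<comment> \<open>An idle service \<open>t\<close> makes the count over \<open>{k..<l}\<close>
    strict, so the old bound leaves room for one more departure.\<close>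
  have tight: "card (D \<inter> {k..}) < card (T \<inter> {k..<l}) + card (S \<inter> {Suc l..})"
    if "t \<in> A" "k \<le> t" "s \<le> l" for t k l
  proof -
    have t: "t \<in> T" "t < s" "t \<notin> D" using that by (auto simp: A_def)
    have kl: "k \<le> l" using that t by simp
    have "D \<inter> {k..<l} \<subset> T \<inter> {k..<l}" using DT t that by auto
    then have "card (D \<inter> {k..<l}) < card (T \<inter> {k..<l})" using T by (simp add: psubset_card_mono)
    moreover have "card (D \<inter> {l..}) \<le> card (S \<inter> {Suc l..})" using ub[of l l] by simp
    ultimately show ?thesis using card_Ico_split[OF fD kl] by simp
  qed
  have D'_hi: "card (D' \<inter> {k..}) = Suc (card (D \<inter> {k..}))" if "A \<noteq> {}" "k \<le> Max A" for k
  proof -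
    have "Max A \<notin> D" using Max_in[OF fA that(1)] by (simp add: A_def)
    moreover have "D' \<inter> {k..} = insert (Max A) (D \<inter> {k..})" using that by (auto simp: D'_def)
    ultimately show ?thesis using fD by simp
  qed
  have D'_lo: "D' \<inter> {k..} = D \<inter> {k..}" if "A = {} \<or> Max A < k" for k
    using that by (auto simp: D'_def)
  have "D' \<subseteq> T" using DT Max_in[OF fA] by (auto simp: D'_def A_def)
  moreover have "card (D' \<inter> {k..}) \<le> card (T \<inter> {k..<l}) + card (insert s S \<inter> {Suc l..})"
    if kl: "k \<le> l" for k l
  proof (cases "A \<noteq> {} \<and> k \<le> Max A")
    case True
    show ?thesis
    proof (cases "l < s")
      case True' : True
      then show ?thesis using Slow[OF True'] D'_hi True ub[OF kl] by simp
    next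
      case False
      then show ?thesis using Shigh[of l] D'_hi[of k] True tight[of "Max A" k l] Max_in[OF fA] by simp
    qed
  next
    case False
    then have "D' \<inter> {k..} = D \<inter> {k..}" by (intro D'_lo) auto
    moreover have "card (S \<inter> {Suc l..}) \<le> card (insert s S \<inter> {Suc l..})"
      using S by (intro card_mono) auto
    ultimately show ?thesis using ub[OF kl] by simp
  qed
  moreover have "\<exists>l\<ge>k. card (D' \<inter> {k..}) = card (T \<inter> {k..<l}) + card (insert s S \<inter> {Suc l..})" for k
  proof (cases "A \<noteq> {} \<and> k \<le> Max A")
    case True
    obtain l where l: "l \<ge> k" "card (D \<inter> {k..}) = card (T \<inter> {k..<l}) + card (S \<inter> {Suc l..})"
      using ex by blast
    then have "l < s" using tight[of "Max A" k l] True Max_in[OF fA] by force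
    then show ?thesis using l D'_hi[of k] True Slow by auto
  next
    case False
    then have D': "D' \<inter> {k..} = D \<inter> {k..}" by (intro D'_lo) auto
    show ?thesis
    proof (cases "k \<le> s")
      case True
      \<comment> \<open>A minimiser for \<open>k\<close> might lie below \<open>s\<close>, where the
        new arrival is charged. A minimiser for \<open>s\<close> does not, and it serves
        \<open>k\<close> as well because every service in \<open>{k..<s}\<close> is already
        used.\<close>
      obtain l where l: "l \<ge> s" "card (D \<inter> {s..}) = card (T \<inter> {s..<l}) + card (S \<inter> {Suc l..})"
        using ex by blast
      have "T \<inter> {k..<s} \<subseteq> D"
      proof
        fix t assume t: "t \<in> T \<inter> {k..<s}"
        show "t \<in> D"
        proof (rule ccontr)
          assume "t \<notin> D"
          then have "t \<in> A" using t by (simp add: A_def)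
          then show False using False Max_ge[OF fA] t by fastforce
        qed
      qed
      then have "D \<inter> {k..<s} = T \<inter> {k..<s}" using DT by auto
      then have "card (D \<inter> {k..}) = card (T \<inter> {k..<s}) + card (D \<inter> {s..})"
        using card_Ico_split[OF fD True] by simp
      also have "\<dots> = card (T \<inter> {k..<l}) + card (S \<inter> {Suc l..})"
      proof -
        have "T \<inter> {k..<l} = (T \<inter> {k..<s}) \<union> (T \<inter> {s..<l})" using l True by auto
        then have "card (T \<inter> {k..<l}) = card (T \<inter> {k..<s}) + card (T \<inter> {s..<l})"
          using T by (simp, subst card_Un_disjoint, auto)
        then show ?thesis using l by simp
      qed
      finally show ?thesis using D' Shigh[OF l(1)] l(1) True
        by (metis dual_order.trans)
    next
      case False
      obtain l where "l \<ge> k" "card (D \<inter> {k..}) = card (T \<inter> {k..<l}) + card (S \<inter> {Suc l..})"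
        using ex by blast
      then show ?thesis using D' Shigh[of l] False by auto
    qed
  qed
  ultimately have "queue_output T (insert s S) D'" unfolding queue_output_def by blast
  then show ?thesis by (simp add: D'_def)
qed

lemma queue_output_tri_aux:
  assumes "finite T"
  shows "finite S \<Longrightarrow> queue_output T S D \<Longrightarrow> sorted_wrt (>) ss \<Longrightarrow>
    (\<forall>x\<in>S. \<forall>y\<in>set ss. y < x) \<Longrightarrow> queue_output T (S \<union> set ss) (tri_aux T ss D)"
proof (induction ss arbitrary: S D)
  case Nil
  then show ?case by simp
next
  case (Cons s ss)
  define A where "A = {t \<in> T. t < s \<and> t \<notin> D}"
  have "queue_output T (insert s S) (if A = {} then D else insert (Max A) D)"
    unfolding A_def using Cons.prems assms by (intro queue_output_insert) auto
  then have "queue_output T (insert s S \<union> set ss)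
      (tri_aux T ss (if A = {} then D else insert (Max A) D))"
    using Cons.prems by (intro Cons.IH) auto
  moreover have "S \<union> set (s # ss) = insert s S \<union> set ss" by auto
  ultimately show ?case by (simp only: tri_aux.simps Let_def A_def)
qed

lemma queue_output_tri:
  assumes "finite T" "finite S"
  shows "queue_output T S (tri T S)"
proof -
  have "sorted_wrt (>) (rev (sorted_list_of_set S))"
    by (simp add: sorted_wrt_rev)
  then have "queue_output T ({} \<union> set (rev (sorted_list_of_set S))) (tri T S)"
    unfolding tri_def using assms queue_output_empty by (intro queue_output_tri_aux) auto
  then show ?thesis using assms by simp
qed

lemma tri_subset: "finite T \<Longrightarrow> finite S \<Longrightarrow> tri T S \<subseteq> T"
  using queue_output_tri by (auto simp: queue_output_def)

lemma card_tri_le: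
  "finite T \<Longrightarrow> finite S \<Longrightarrow> k \<le> l \<Longrightarrow>
    card (tri T S \<inter> {k..}) \<le> card (T \<inter> {k..<l}) + card (S \<inter> {Suc l..})"
  using queue_output_tri unfolding queue_output_def by blast

lemma card_tri_attained:
  assumes "finite T" "finite S"
  obtains l where "k \<le> l" "card (tri T S \<inter> {k..}) = card (T \<inter> {k..<l}) + card (S \<inter> {Suc l..})"
  using queue_output_tri[OF assms] unfolding queue_output_def by blast

lemma card_atLeast_step:
  fixes A :: "nat set"
  assumes "finite A"
  shows "card (A \<inter> {k..}) = (if k \<in> A then 1 else 0) + card (A \<inter> {Suc k..})"
proof -
  have "A \<inter> {k..<Suc k} = (if k \<in> A then {k} else {})" by auto
  then show ?thesis using card_Ico_split[OF assms, of k "Suc k"] by simp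
qed

text \<open>If a service \<open>t\<close> is idle under the arrivals \<open>S2\<close>, the queue is
  empty there: all arrivals above \<open>t\<close> have departed above \<open>t\<close>. With fewer
  arrivals the queue is empty at \<open>t\<close> too, so \<open>t\<close> is idle again.\<close>

lemma tri_mono:
  assumes T: "finite T" and S2: "finite S2" and sub: "S1 \<subseteq> S2"
  shows "tri T S1 \<subseteq> tri T S2"
proof
  have S1: "finite S1" using S2 sub finite_subset by blast
  have f1: "finite (tri T S1)" and f2: "finite (tri T S2)"
    using finite_subset[OF tri_subset T] T S1 S2 by auto
  fix t assume t1: "t \<in> tri T S1"
  then have tT: "t \<in> T" using tri_subset T S1 by blast
  show "t \<in> tri T S2"
  proof (rule ccontr)
    assume t2: "t \<notin> tri T S2"
    obtain l where l: "t \<le> l" "card (tri T S2 \<inter> {t..}) = card (T \<inter> {t..<l}) + card (S2 \<inter> {Suc l..})"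
      using card_tri_attained[OF T S2] by blast
    \<comment> \<open>For \<open>l > t\<close>, starting the window at \<open>Suc t\<close> would
      save the idle service \<open>t\<close> and undercut the actual count.\<close>
    have "l = t"
    proof (rule ccontr)
      assume "l \<noteq> t"
      then have "Suc t \<le> l" using l by simp
      moreover have "T \<inter> {t..<l} = insert t (T \<inter> {Suc t..<l})" using tT \<open>Suc t \<le> l\<close> by auto
      ultimately show False
        using card_tri_le[OF T S2, of "Suc t" l] l(2) card_atLeast_step[OF f2, of t] t2 T by simp
    qed
    then have e2: "card (tri T S2 \<inter> {Suc t..}) = card (S2 \<inter> {Suc t..})"
      using l card_atLeast_step[OF f2, of t] t2 by simp
    obtain l' where l': "Suc t \<le> l'"
      "card (tri T S1 \<inter> {Suc t..}) = card (T \<inter> {Suc t..<l'}) + card (S1 \<inter> {Suc l'..})"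
      using card_tri_attained[OF T S1] by blast
    have "card (S1 \<inter> {Suc t..<Suc l'}) \<le> card (S2 \<inter> {Suc t..<Suc l'})"
      using sub S2 by (intro card_mono) auto
    moreover have "card (S1 \<inter> {Suc t..}) = card (S1 \<inter> {Suc t..<Suc l'}) + card (S1 \<inter> {Suc l'..})"
      using l' by (intro card_Ico_split S1) auto
    moreover have "card (S2 \<inter> {Suc t..}) = card (S2 \<inter> {Suc t..<Suc l'}) + card (S2 \<inter> {Suc l'..})"
      using l' by (intro card_Ico_split S2) auto
    ultimately show False
      using card_tri_le[OF T S2 l'(1)] e2 l'(2) card_tri_le[OF T S1 order_refl, of t]
        card_atLeast_step[OF f1, of t] t1 by simp
  qed
qed

text \<open>In the minimum formula for \<open>k = 0\<close> the hypothesis makes every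
  \<open>l\<close> cost at least \<open>card S\<close>, so every arrival is served.\<close>

lemma card_tri_eq:
  assumes T: "finite T" and S: "finite S"
    and le: "\<And>l. card (S \<inter> {..l}) \<le> card (T \<inter> {..<l})"
  shows "card (tri T S) = card S"
proof (rule antisym)
  show "card (tri T S) \<le> card S"
    using card_tri_le[OF T S, of 0 0] card_mono[OF S, of "S \<inter> {Suc 0..}"] by (simp add: atLeast_0)
next
  obtain l where l: "card (tri T S \<inter> {0..}) = card (T \<inter> {0..<l}) + card (S \<inter> {Suc l..})"
    using card_tri_attained[OF T S] by blast
  have "S = S \<inter> {..l} \<union> S \<inter> {Suc l..}" by auto
  then have "card S \<le> card (S \<inter> {..l}) + card (S \<inter> {Suc l..})"
    by (metis card_Un_le)
  then show "card S \<le> card (tri T S)" using l le[of l] by (simp add: atLeast_0 atLeast0LessThan)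
qed

section \<open>First passage description of the left key\<close>

text \<open>Entries are counted by their rows instead of their values, so that costs in two tableaux
  or in neighbouring columns can be compared row by row.\<close>

definition rows_in :: "tableau \<Rightarrow> nat \<Rightarrow> nat set \<Rightarrow> nat set" where
  "rows_in P d I = {i. \<exists>v\<in>I. P (i, d) = Some v}"

definition column_injective :: "tableau \<Rightarrow> bool" where
  "column_injective P \<longleftrightarrow> (\<forall>i i' d v. P (i, d) = Some v \<and> P (i', d) = Some v \<longrightarrow> i = i')"

definition height :: "tableau \<Rightarrow> nat \<Rightarrow> nat" where
  "height P d = card (rows_in P d UNIV)"

lemma rows_in_UNIV: "rows_in P d UNIV = {i. P (i, d) \<noteq> None}"
  by (auto simp: rows_in_def)

lemma finite_rows_in: "finite (dom P) \<Longrightarrow> finite (rows_in P d I)"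
proof -
  assume "finite (dom P)"
  moreover have "rows_in P d I \<subseteq> fst ` dom P" by (force simp: rows_in_def)
  ultimately show ?thesis by (meson finite_imageI finite_subset)
qed

lemma finite_col_set: "finite (dom P) \<Longrightarrow> finite (col_set P d)"
proof -
  assume "finite (dom P)"
  moreover have "col_set P d \<subseteq> (the \<circ> P) ` dom P" by (force simp: col_set_def)
  ultimately show ?thesis by (meson finite_imageI finite_subset)
qed

lemma card_col_set_Int:
  assumes "column_injective P"
  shows "card (col_set P d \<inter> I) = card (rows_in P d I)"
proof -
  have "bij_betw (\<lambda>i. the (P (i, d))) (rows_in P d I) (col_set P d \<inter> I)"
    using assms by (fastforce simp: bij_betw_def inj_on_def rows_in_def col_set_def column_injective_def image_iff)
  then show ?thesis by (simp add: bij_betw_same_card)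
qed

text \<open>A rising sequence \<open>u\<close> is a lattice path that uses column \<open>d\<close> on the values in \<open>window u n d\<close>.
  The value \<open>u (d + 1) - 1\<close>, at which the path changes from column \<open>d\<close> to column \<open>d + 1\<close>, is
  skipped because each \<open>s\<close> picks a strictly smaller element. The last window is unbounded.\<close>

definition rising :: "nat \<Rightarrow> nat \<Rightarrow> (nat \<Rightarrow> nat) \<Rightarrow> bool" where
  "rising i n u \<longleftrightarrow> (\<forall>d. i \<le> d \<and> d < n \<longrightarrow> u d < u (Suc d))"

definition window :: "(nat \<Rightarrow> nat) \<Rightarrow> nat \<Rightarrow> nat \<Rightarrow> nat set" where
  "window u n d = {v. u d \<le> v \<and> (d < n \<longrightarrow> Suc v < u (Suc d))}"

definition cost :: "tableau \<Rightarrow> nat \<Rightarrow> nat \<Rightarrow> (nat \<Rightarrow> nat) \<Rightarrow> nat" where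
  "cost P i n u = (\<Sum>d = i..n. card (rows_in P d (window u n d)))"

lemma rising_less: "rising i n u \<Longrightarrow> i \<le> d \<Longrightarrow> d < e \<Longrightarrow> e \<le> n \<Longrightarrow> u d < u e"
proof (induction e)
  case (Suc e)
  then have "u e < u (Suc e)" by (simp add: rising_def)
  then show ?case using Suc by (cases "d = e") auto
qed simp

lemma cost_Suc_left:
  "i < n \<Longrightarrow> cost P i n u = card (rows_in P i (window u n i)) + cost P (Suc i) n u"
  by (simp add: cost_def sum.atLeast_Suc_atMost)

lemma window_step: "i < n \<Longrightarrow> u (Suc i) = Suc l \<Longrightarrow> window u n i = {u i..<l}"
  by (auto simp: window_def)

lemma finite_nest: "finite (dom P) \<Longrightarrow> finite (nest P i j)"
proof (induction j arbitrary: i)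
  case (Suc j)
  then show ?case
    using finite_subset[OF tri_subset finite_col_set] finite_col_set by auto
qed (simp add: finite_col_set)

lemma nest_subset_col_set: "finite (dom P) \<Longrightarrow> nest P i j \<subseteq> col_set P i"
  by (cases j) (simp_all add: tri_subset finite_col_set finite_nest)

lemma nest_Suc_subset: "finite (dom P) \<Longrightarrow> nest P i (Suc j) \<subseteq> nest P i j"
proof (induction j arbitrary: i)
  case 0
  then show ?case by (simp add: tri_subset finite_col_set)
next
  case (Suc j)
  then show ?case by (metis nest.simps(2) tri_mono finite_col_set finite_nest)
qed

lemma card_nest_le_cost:
  assumes P: "finite (dom P)" "column_injective P"
  shows "rising i (i + j) u \<Longrightarrow> card (nest P i j \<inter> {u i..}) \<le> cost P i (i + j) u"
proof (induction j arbitrary: i)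
  case 0
  have "window u i i = {u i..}" by (auto simp: window_def)
  then show ?case using card_col_set_Int[OF P(2), of i "{u i..}"] by (simp add: cost_def)
next
  case (Suc j)
  have lt: "u i < u (Suc i)" using Suc.prems by (simp add: rising_def)
  \<comment> \<open>The \<open>l\<close> of the queue formula is \<open>u (Suc i) - 1\<close>, since
    arrivals are counted from \<open>Suc l\<close> on.\<close>
  then obtain l where l: "u (Suc i) = Suc l" "u i \<le> l" by (metis less_Suc_eq_le not0_implies_Suc not_less0)
  have "card (nest P (Suc i) j \<inter> {Suc l..}) \<le> cost P (Suc i) (i + Suc j) u"
    using Suc.IH[of "Suc i"] Suc.prems l by (simp add: rising_def)
  moreover have "card (nest P i (Suc j) \<inter> {u i..})
      \<le> card (col_set P i \<inter> {u i..<l}) + card (nest P (Suc i) j \<inter> {Suc l..})"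
    using card_tri_le[OF finite_col_set finite_nest l(2)] P by simp
  ultimately show ?case
    using card_col_set_Int[OF P(2)] window_step[of i "i + Suc j" u l] l
    by (simp add: cost_Suc_left)
qed

lemma cost_cong:
  assumes "\<And>d. i \<le> d \<Longrightarrow> d \<le> n \<Longrightarrow> u d = u' d"
  shows "cost P i n u = cost P i n u'"
proof -
  have "window u n d = window u' n d" if "d \<in> {i..n}" for d
    using assms that by (auto simp: window_def)
  then show ?thesis unfolding cost_def by (intro sum.cong) auto
qed

text \<open>The minimiser \<open>l\<close> for column \<open>i\<close> fixes the start
  \<open>Suc l\<close> for the next column, so the minimisers chain into one path. This is why
  \<open>k\<close> varies in the induction.\<close>

lemma card_nest_attained:
  assumes P: "finite (dom P)" "column_injective P"
  shows "\<exists>u. rising i (i + j) u \<and> u i = k \<and> card (nest P i j \<inter> {k..}) = cost P i (i + j) u"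
proof (induction j arbitrary: i k)
  case 0
  have "window (\<lambda>_. k) i i = {k..}" by (auto simp: window_def)
  then show ?case using card_col_set_Int[OF P(2), of i "{k..}"]
    by (intro exI[of _ "\<lambda>_. k"]) (simp add: cost_def rising_def)
next
  case (Suc j)
  obtain l where l: "k \<le> l" "card (nest P i (Suc j) \<inter> {k..})
      = card (col_set P i \<inter> {k..<l}) + card (nest P (Suc i) j \<inter> {Suc l..})"
    using card_tri_attained[OF finite_col_set finite_nest] P by (metis nest.simps(2))
  obtain u where u: "rising (Suc i) (Suc i + j) u" "u (Suc i) = Suc l"
    "card (nest P (Suc i) j \<inter> {Suc l..}) = cost P (Suc i) (Suc i + j) u"
    using Suc.IH by blast
  define u' where "u' = u(i := k)"
  have "rising i (i + Suc j) u'" using u l by (auto simp: rising_def u'_def)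
  moreover have "cost P (Suc i) (Suc i + j) u' = cost P (Suc i) (Suc i + j) u"
    by (rule cost_cong) (simp add: u'_def)
  moreover have "window u' (i + Suc j) i = {k..<l}"
    using window_step[of i "i + Suc j" u' l] u by (simp add: u'_def)
  moreover have "u' i = k" by (simp add: u'_def)
  ultimately show ?case using l u card_col_set_Int[OF P(2)]
    by (intro exI[of _ u']) (simp add: cost_Suc_left)
qed

abbreviation passage :: "tableau \<Rightarrow> nat \<Rightarrow> nat \<Rightarrow> nat" where
  "passage P n k \<equiv> card (key_col P n \<inter> {k..})"

lemma passage_le_cost:
  assumes "finite (dom P)" "column_injective P" "1 \<le> n" "rising 1 n u"
  shows "passage P n (u 1) \<le> cost P 1 n u"
  using card_nest_le_cost[OF assms(1,2), of 1 "n - 1" u] assms(3,4) by (simp add: key_col_def)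

lemma passage_attained:
  assumes "finite (dom P)" "column_injective P" "1 \<le> n"
  obtains u where "rising 1 n u" "u 1 = k" "passage P n k = cost P 1 n u"
  using card_nest_attained[OF assms(1,2), of 1 "n - 1" k] assms(3) by (auto simp: key_col_def)

text \<open>The path stays in column \<open>n\<close> instead of switching to column
  \<open>Suc n\<close>. The rows this may add have an entry at least \<open>q - 1\<close> in column
  \<open>n\<close>; they are disjoint from the rows with an entry below \<open>q\<close> in column
  \<open>Suc n\<close>, whose left neighbours are smaller still.\<close>

lemma cost_extend:
  assumes Q: "finite (dom Q)"
    and row: "\<And>i w. Q (i, Suc n) = Some w \<Longrightarrow> \<exists>y<w. Q (i, n) = Some y"
    and n: "1 \<le> n"
  shows "cost Q 1 n u + height Q (Suc n) \<le> cost Q 1 (Suc n) u + height Q n"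
proof -
  note fin = finite_rows_in[OF Q]
  define q where "q = u (Suc n)"
  have "(\<Sum>d = 1..<n. card (rows_in Q d (window u n d))) = (\<Sum>d = 1..<n. card (rows_in Q d (window u (Suc n) d)))"
    by (intro sum.cong) (auto simp: window_def)
  moreover have "{1..n} = insert n {1..<n}" "{1..Suc n} = insert (Suc n) (insert n {1..<n})"
    using n by auto
  ultimately have "cost Q 1 n u + card (rows_in Q n (window u (Suc n) n)) + card (rows_in Q (Suc n) {q..})
     = cost Q 1 (Suc n) u + card (rows_in Q n {u n..})"
    by (auto simp: cost_def window_def q_def atLeast_def)
  moreover have "card (rows_in Q n {u n..}) \<le> card (rows_in Q n (window u (Suc n) n)) + card (rows_in Q n {v. q \<le> Suc v})"
  proof -
    have "rows_in Q n {u n..} \<subseteq> rows_in Q n (window u (Suc n) n) \<union> rows_in Q n {v. q \<le> Suc v}"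
      by (auto simp: rows_in_def window_def q_def)
    then show ?thesis using fin by (meson card_Un_le card_mono finite_UnI order_trans)
  qed
  moreover have "height Q (Suc n) \<le> card (rows_in Q (Suc n) {q..}) + card (rows_in Q (Suc n) {..<q})"
  proof -
    have "rows_in Q (Suc n) UNIV = rows_in Q (Suc n) {q..} \<union> rows_in Q (Suc n) {..<q}"
      by (auto simp: rows_in_def)
    then show ?thesis unfolding height_def by (simp add: card_Un_le)
  qed
  moreover have "card (rows_in Q n {v. q \<le> Suc v}) + card (rows_in Q (Suc n) {..<q}) \<le> height Q n"
  proof -
    have "rows_in Q n {v. q \<le> Suc v} \<inter> rows_in Q (Suc n) {..<q} = {}"
      using row by (fastforce simp: rows_in_def)
    moreover have "rows_in Q n {v. q \<le> Suc v} \<union> rows_in Q (Suc n) {..<q} \<subseteq> rows_in Q n UNIV"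
      using row by (fastforce simp: rows_in_def)
    ultimately show ?thesis unfolding height_def using fin
      by (metis card_Un_disjoint card_mono)
  qed
  ultimately show ?thesis by linarith
qed

section \<open>Increasing tableaux and the sizes of key columns\<close>

lemma increasing_tableauD:
  assumes "increasing_tableau P"
  shows increasing_finite: "finite (dom P)"
    and increasing_index_pos: "P (r, c) = Some a \<Longrightarrow> 1 \<le> r \<and> 1 \<le> c"
    and increasing_cell: "P (r, c) = Some a \<Longrightarrow> 1 \<le> r' \<Longrightarrow> r' \<le> r \<Longrightarrow> 1 \<le> c' \<Longrightarrow> c' \<le> c \<Longrightarrow> \<exists>b. P (r', c') = Some b"
    and increasing_row_less: "P (r, c) = Some a \<Longrightarrow> P (r, c') = Some b \<Longrightarrow> c < c' \<Longrightarrow> a < b"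
    and increasing_col_less: "P (r, c) = Some a \<Longrightarrow> P (r', c) = Some b \<Longrightarrow> r < r' \<Longrightarrow> a < b"
proof -
  note inc = assms[unfolded increasing_tableau_def young_shape_def]
  note fin = inc[THEN conjunct1, THEN conjunct1]
  note young = inc[THEN conjunct1, THEN conjunct2, THEN spec, THEN spec, THEN mp]
  note row = inc[THEN conjunct2, THEN conjunct2, THEN conjunct1]
  note col = inc[THEN conjunct2, THEN conjunct2, THEN conjunct2]
  show "finite (dom P)" by (rule fin)
  show "P (r, c) = Some a \<Longrightarrow> 1 \<le> r \<and> 1 \<le> c" using young[of r c] by auto
  show "P (r, c) = Some a \<Longrightarrow> 1 \<le> r' \<Longrightarrow> r' \<le> r \<Longrightarrow> 1 \<le> c' \<Longrightarrow> c' \<le> c \<Longrightarrow> \<exists>b. P (r', c') = Some b"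
    using young[of r c] by auto
  show "P (r, c) = Some a \<Longrightarrow> P (r, c') = Some b \<Longrightarrow> c < c' \<Longrightarrow> a < b" using row by blast
  show "P (r, c) = Some a \<Longrightarrow> P (r', c) = Some b \<Longrightarrow> r < r' \<Longrightarrow> a < b" using col by blast
qed

lemma increasing_row_le:
  "increasing_tableau P \<Longrightarrow> P (r, c) = Some a \<Longrightarrow> P (r, c') = Some b \<Longrightarrow> c \<le> c' \<Longrightarrow> a \<le> b"
  by (metis increasing_row_less le_eq_less_or_eq option.inject)

lemma increasing_col_le:
  "increasing_tableau P \<Longrightarrow> P (r, c) = Some a \<Longrightarrow> P (r', c) = Some b \<Longrightarrow> r \<le> r' \<Longrightarrow> a \<le> b"
  by (metis increasing_col_less le_eq_less_or_eq option.inject)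

lemma increasing_row_less_iff:
  "increasing_tableau P \<Longrightarrow> P (r, c) = Some a \<Longrightarrow> P (r, c') = Some b \<Longrightarrow> c < c' \<longleftrightarrow> a < b"
  by (meson increasing_row_le increasing_row_less leD leI)

lemma increasing_col_less_iff:
  "increasing_tableau P \<Longrightarrow> P (r, c) = Some a \<Longrightarrow> P (r', c) = Some b \<Longrightarrow> r < r' \<longleftrightarrow> a < b"
  by (meson increasing_col_le increasing_col_less leD leI)

lemma increasing_column_injective: "increasing_tableau P \<Longrightarrow> column_injective P"
  unfolding column_injective_def by (metis increasing_col_less less_irrefl nat_neq_iff)

lemma increasing_rows_in_UNIV:
  assumes P: "increasing_tableau P"
  shows "rows_in P d UNIV = {1..height P d}"
proof -
  let ?X = "rows_in P d UNIV"
  have fin: "finite ?X" using P by (simp add: finite_rows_in increasing_finite)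
  show ?thesis
  proof (cases "?X = {}")
    case True
    then show ?thesis by (simp add: height_def)
  next
    case False
    have "?X = {1..Max ?X}"
    proof
      show "?X \<subseteq> {1..Max ?X}"
        using fin increasing_index_pos[OF P] by (auto simp: rows_in_def)
      obtain v where v: "P (Max ?X, d) = Some v"
        using Max_in[OF fin False] by (auto simp: rows_in_def)
      then have "1 \<le> d" using increasing_index_pos[OF P] by blast
      then show "{1..Max ?X} \<subseteq> ?X"
        using increasing_cell[OF P v] by (fastforce simp: rows_in_def)
    qed
    then show ?thesis unfolding height_def by (metis card_atLeastAtMost diff_Suc_1)
  qed
qed

text \<open>The left neighbour of an entry \<open>\<le> l\<close> of column \<open>Suc i\<close> is
  \<open>< l\<close>, so services never fall short of arrivals and \<open>card_tri_eq\<close>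
  applies at every level of the nesting.\<close>

lemma card_nest:
  assumes P: "increasing_tableau P" and i: "1 \<le> i"
  shows "card (nest P i j) = height P (i + j)"
  using i
proof (induction j arbitrary: i)
  case 0
  then show ?case
    using card_col_set_Int[OF increasing_column_injective[OF P], of i UNIV] by (simp add: height_def)
next
  case (Suc j)
  note fin = increasing_finite[OF P]
  have "card (nest P (Suc i) j \<inter> {..l}) \<le> card (col_set P i \<inter> {..<l})" for l
  proof -
    have "card (nest P (Suc i) j \<inter> {..l}) \<le> card (col_set P (Suc i) \<inter> {..l})"
      using nest_subset_col_set[OF fin, of "Suc i" j] finite_col_set[OF fin] by (intro card_mono) auto
    also have "\<dots> = card (rows_in P (Suc i) {..l})"
      using card_col_set_Int[OF increasing_column_injective[OF P]] by blast
    also have "\<dots> \<le> card (rows_in P i {..<l})"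
    proof (rule card_mono[OF finite_rows_in[OF fin]], rule subsetI)
      fix r assume "r \<in> rows_in P (Suc i) {..l}"
      then obtain v where v: "P (r, Suc i) = Some v" "v \<le> l" by (auto simp: rows_in_def)
      obtain w where w: "P (r, i) = Some w"
        using increasing_cell[OF P v(1), of r i] increasing_index_pos[OF P v(1)] Suc.prems by auto
      then have "w < v" using increasing_row_less[OF P w v(1)] by simp
      then show "r \<in> rows_in P i {..<l}" using v w by (auto simp: rows_in_def)
    qed
    also have "\<dots> = card (col_set P i \<inter> {..<l})"
      using card_col_set_Int[OF increasing_column_injective[OF P]] by simp
    finally show ?thesis .
  qed
  then have "card (nest P i (Suc j)) = card (nest P (Suc i) j)"
    using card_tri_eq[OF finite_col_set[OF fin] finite_nest[OF fin]] by simp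
  then show ?case using Suc.IH[of "Suc i"] by simp
qed

lemma card_key_col: "increasing_tableau P \<Longrightarrow> 1 \<le> j \<Longrightarrow> card (key_col P j) = height P j"
  by (simp add: key_col_def card_nest)

lemma finite_key_col: "finite (dom P) \<Longrightarrow> finite (key_col P j)"
  by (simp add: key_col_def finite_nest)

text \<open>\<open>left_key\<close> writes a key column into the cells of \<open>Q\<close>, so the
  set survives when the cells are as many as the key elements. For the output tableau this fit is
  obtained by comparison with \<open>P\<close>.\<close>

lemma col_set_left_key:
  assumes "finite (dom Q)" and rows: "rows_in Q j UNIV = {1..card (key_col Q j)}"
  shows "col_set (left_key Q) j = key_col Q j"
proof -
  let ?K = "key_col Q j"
  let ?xs = "sorted_list_of_set ?K"
  have fin: "finite ?K" using assms(1) by (rule finite_key_col)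
  have mem: "(r, j) \<in> dom Q \<longleftrightarrow> 1 \<le> r \<and> r \<le> card ?K" for r
    using rows by (auto simp: rows_in_def set_eq_iff)
  have "col_set (left_key Q) j = (\<lambda>r. ?xs ! (r - 1)) ` {1..card ?K}"
    using mem by (auto simp: col_set_def left_key_def)
  also have "\<dots> = (!) ?xs ` {..<length ?xs}"
  proof -
    have "{1..card ?K} = Suc ` {..<length ?xs}" using fin by (simp add: image_Suc_lessThan)
    then show ?thesis by (simp only: image_image) simp
  qed
  also have "\<dots> = set ?xs" by (auto simp: set_conv_nth)
  also have "\<dots> = ?K" using fin by simp
  finally show ?thesis .
qed

section \<open>Exchange of entries along a staircase\<close>

text \<open>Moving one switching value alters the windows of two adjacent columns; a loss in one is
  to be paid for by a gain in the other.\<close>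

lemma sum_le_pair:
  fixes f g :: "nat \<Rightarrow> nat"
  assumes "finite A" "d \<in> A" "e \<in> A" "d \<noteq> e"
    and "\<And>x. x \<in> A \<Longrightarrow> x \<noteq> d \<Longrightarrow> x \<noteq> e \<Longrightarrow> f x \<le> g x"
    and "f d + f e \<le> g d + g e"
  shows "sum f A \<le> sum g A"
proof -
  have A: "A = insert d (insert e (A - {d, e}))" using assms by auto
  have "sum h A = h d + h e + sum h (A - {d, e})" for h :: "nat \<Rightarrow> nat"
    using assms by (subst A) simp
  moreover have "sum f (A - {d, e}) \<le> sum g (A - {d, e})" using assms by (intro sum_mono) auto
  ultimately show ?thesis using assms(6) by simp
qed

text \<open>All that the key needs to know about \<open>P'\<close>: changed cells form a staircase going up and to the
  right, entries only grow, and a new (respectively old) value of a changed cell is either cancelled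
  by the next changed cell of the same column or can be bypassed through the column to the left
  (respectively right).\<close>

locale tableau_exchange =
  fixes P P' :: tableau
  assumes inc: "increasing_tableau P"
    and entry_grows: "P' (i, d) = Some w \<Longrightarrow> \<exists>v\<le>w. P (i, d) = Some v"
    and col_le: "1 \<le> i \<Longrightarrow> i < i' \<Longrightarrow> P (i', d) = Some w \<Longrightarrow> \<exists>y\<le>w. P' (i, d) = Some y"
    and row_less: "1 \<le> d \<Longrightarrow> P (i, Suc d) = Some w \<Longrightarrow> \<exists>y<w. P' (i, d) = Some y"
    and staircase: "P' (i, d) \<noteq> P (i, d) \<Longrightarrow> P' (i', d') \<noteq> P (i', d') \<Longrightarrow> d' < d \<Longrightarrow>
      i < i' \<and> (\<exists>y m. P' (i, d) = Some y \<and> P (i', d') = Some m \<and> y \<le> m)"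
    and left_exit: "P' (i, d) = Some y \<Longrightarrow> P (i, d) \<noteq> Some y \<Longrightarrow>
      2 \<le> d \<and> (\<forall>w. P (Suc i, d - 1) = Some w \<longrightarrow> y \<le> w) \<or>
      P (Suc i, d) = Some y \<and> P' (Suc i, d) \<noteq> Some y"
    and right_exit: "P (i, d) = Some m \<Longrightarrow> P' (i, d) \<noteq> Some m \<Longrightarrow>
      i = 1 \<or> (\<exists>w\<le>m. P (i - 1, Suc d) = Some w) \<or> P' (i - 1, d) = Some m"
begin

lemmas fin = increasing_finite[OF inc]
lemmas inj = increasing_column_injective[OF inc]
lemmas index_pos = increasing_index_pos[OF inc]
lemmas cell = increasing_cell[OF inc]

lemma dom_subset: "dom P' \<subseteq> dom P"
  using entry_grows by fastforce

lemma fin': "finite (dom P')"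
  using dom_subset fin finite_subset by blast

lemmas fin_rows = finite_rows_in[OF fin] finite_rows_in[OF fin']

text \<open>A repeated value would have to be new in row \<open>i\<close> and old in row
  \<open>i'\<close>. A bypass fails because the left neighbour of \<open>(Suc i, d)\<close> is below
  \<open>v\<close>, and a cancellation contradicts the repetition.\<close>

lemma inj'_aux:
  assumes "P' (i, d) = Some v" "P' (i', d) = Some v" "i < i'"
  shows False
proof -
  obtain a b where ab: "P (i, d) = Some a" "P (i', d) = Some b" "b \<le> v"
    using entry_grows assms by meson
  have pos: "1 \<le> i" "1 \<le> d" using index_pos[OF ab(1)] by auto
  have "v \<le> b" using col_le[OF pos(1) assms(3) ab(2)] assms(1) by auto
  then have b: "b = v" using ab by simp
  have "a < v" using increasing_col_less[OF inc ab(1,2) assms(3)] b by simp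
  then have "P (i, d) \<noteq> Some v" using ab by simp
  from left_exit[OF assms(1) this] show False
  proof
    assume *: "2 \<le> d \<and> (\<forall>w. P (Suc i, d - 1) = Some w \<longrightarrow> v \<le> w)"
    obtain x where x: "P (Suc i, d) = Some x" using cell[OF ab(2), of "Suc i" d] assms(3) pos by auto
    have "2 \<le> d" using * by blast
    then have "1 \<le> d - 1" by simp
    then obtain w where w: "P (Suc i, d - 1) = Some w" using cell[OF x, of "Suc i" "d - 1"] by auto
    have "w < x" using increasing_row_less[OF inc w x] * by simp
    moreover have "x \<le> v" using increasing_col_le[OF inc x ab(2)] assms(3) b by simp
    ultimately show False using * w by fastforce
  next
    assume *: "P (Suc i, d) = Some v \<and> P' (Suc i, d) \<noteq> Some v"
    then have "Suc i = i'" using ab(2) b inj unfolding column_injective_def by blast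
    then show False using * assms(2) by simp
  qed
qed

lemma inj': "column_injective P'"
  unfolding column_injective_def using inj'_aux by (metis nat_neq_iff)

text \<open>Only an entry that grows into its window from below can make the path dearer in
  \<open>P'\<close>, and the staircase confines such entries to one column \<open>d\<close>. There
  \<open>left_exit\<close> is applied to the bottommost changed cell whose new value lies in the
  window.\<close>

lemma cost_decreases:
  assumes n: "1 \<le> n" and u: "rising 1 n u"
  shows "\<exists>u'. rising 1 n u' \<and> u' 1 = u 1 \<and> cost P' 1 n u' \<le> cost P 1 n u"
proof -
  define I where "I d = window u n d" for d
  define X where "X d = rows_in P d (I d)" for d
  define X' where "X' d = rows_in P' d (I d)" for d
  have finX: "finite (X d)" "finite (X' d)" for d using fin_rows by (auto simp: X_def X'_def)
  have I: "v \<in> I d \<longleftrightarrow> u d \<le> v \<and> (d < n \<longrightarrow> Suc v < u (Suc d))" for v d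
    by (simp add: I_def window_def)
  have cost_u: "cost P 1 n u = (\<Sum>d = 1..n. card (X d))" "cost P' 1 n u = (\<Sum>d = 1..n. card (X' d))"
    by (simp_all add: cost_def I_def X_def X'_def)
  define low where "low i d \<longleftrightarrow> (\<exists>v y. P (i, d) = Some v \<and> P' (i, d) = Some y \<and> v < u d \<and> y \<in> I d)" for i d
  have not_low: "i \<in> X d" if i: "i \<in> X' d" "\<not> low i d" for i d
  proof -
    obtain y where y: "P' (i, d) = Some y" "y \<in> I d" using i by (auto simp: X'_def rows_in_def)
    obtain v where v: "P (i, d) = Some v" "v \<le> y" using entry_grows[OF y(1)] by auto
    then have "u d \<le> v" using i y v unfolding low_def by force
    then show ?thesis using v y by (auto simp: X_def rows_in_def I)
  qed
  show ?thesis
  proof (cases "\<exists>d\<in>{1..n}. \<exists>i. low i d")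
    case False
    then have "X' d \<subseteq> X d" if "d \<in> {1..n}" for d using not_low that by blast
    then have "cost P' 1 n u \<le> cost P 1 n u"
      unfolding cost_u using finX by (intro sum_mono card_mono) auto
    then show ?thesis using u by blast
  next
    case True
    then obtain i0 d v0 y0 where d: "1 \<le> d" "d \<le> n"
      and v0: "P (i0, d) = Some v0" "P' (i0, d) = Some y0" "v0 < u d" "y0 \<in> I d"
      by (auto simp: low_def)
    have ch0: "P' (i0, d) \<noteq> P (i0, d)" using v0 by (auto simp: I)
    \<comment> \<open>Of two such entries in different columns, the right one has a new value at
      most the old value of the left one, although windows increase to the right.\<close>
    have other: "X' e \<subseteq> X e" if e: "1 \<le> e" "e \<le> n" "e \<noteq> d" for e
    proof
      fix i assume i: "i \<in> X' e"
      have "\<not> low i e"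
      proof
        assume "low i e"
        then obtain w w' where w: "P (i, e) = Some w" "P' (i, e) = Some w'" "w < u e" "w' \<in> I e"
          by (auto simp: low_def)
        have ch: "P' (i, e) \<noteq> P (i, e)" using w by (auto simp: I)
        show False
        proof (cases "e < d")
          case True
          then have "y0 \<le> w" using staircase[OF ch0 ch] v0 w by auto
          moreover have "u e < u d" using rising_less[OF u] e d True by simp
          ultimately show False using w v0 by (simp add: I)
        next
          case False
          then have "w' \<le> v0" using staircase[OF ch ch0] v0 w e by auto
          moreover have "u d < u e" using rising_less[OF u] e d False by simp
          ultimately show False using w v0 by (simp add: I)
        qed
      qed
      then show "i \<in> X e" using i not_low by blast
    qed
    define S where "S = {b. \<exists>m y. P (b, d) = Some m \<and> P' (b, d) = Some y \<and> m \<noteq> y \<and> y \<in> I d}"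
    have "S \<subseteq> X' d" by (auto simp: S_def X'_def rows_in_def)
    then have finS: "finite S" using finX finite_subset by blast
    have i0S: "i0 \<in> S" using v0 by (auto simp: S_def I)
    \<comment> \<open>By the choice of the bottommost row, in the cancelling case the cell below
      loses \<open>y\<close> without bringing in another value of the window.\<close>
    define b where "b = Max S"
    have "b \<in> S" using finS i0S by (metis Max_in b_def empty_iff)
    then obtain m y where b: "P (b, d) = Some m" "P' (b, d) = Some y" "m \<noteq> y" "y \<in> I d"
      by (auto simp: S_def)
    have my: "m \<le> y" using entry_grows[OF b(2)] b by auto
    have b1: "1 \<le> b" using index_pos b by blast
    have "P (b, d) \<noteq> Some y" using b by simp
    from left_exit[OF b(2) this] show ?thesis
    proof
      assume *: "P (Suc b, d) = Some y \<and> P' (Suc b, d) \<noteq> Some y"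
      have bX: "Suc b \<in> X d" using * b by (auto simp: X_def rows_in_def)
      have bX': "Suc b \<notin> X' d"
      proof
        assume "Suc b \<in> X' d"
        then have "Suc b \<in> S" using * by (auto simp: S_def X'_def rows_in_def)
        then show False using Max_ge[OF finS, of "Suc b"] by (simp add: b_def)
      qed
      have "X' d \<subseteq> insert i0 (X d - {Suc b})"
      proof
        fix i assume i: "i \<in> X' d"
        show "i \<in> insert i0 (X d - {Suc b})"
        proof (cases "low i d")
          case False
          then show ?thesis using not_low[OF i] bX' i by auto
        next
          case True
          then obtain w w' where w: "P (i, d) = Some w" "P' (i, d) = Some w'" "w < u d" "w' \<in> I d"
            by (auto simp: low_def)
          \<comment> \<open>Only one row can be \<open>low\<close>: by \<open>col_le\<close> the new
            entry of an upper row is at most the old entry of a lower one, which is still below the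
            window.\<close>
          have "\<not> i < i0" using col_le[OF _ _ v0(1), of i] index_pos[OF w(1)] w v0 by (force simp: I)
          moreover have "\<not> i0 < i" using col_le[OF _ _ w(1), of i0] index_pos[OF v0(1)] w v0 by (force simp: I)
          ultimately show ?thesis by simp
        qed
      qed
      then have "card (X' d) \<le> card (insert i0 (X d - {Suc b}))" using finX by (intro card_mono) auto
      also have "\<dots> \<le> Suc (card (X d - {Suc b}))" by (simp add: card_insert_le_m1 card_insert_if finX)
      also have "\<dots> = card (X d)" using card_Suc_Diff1[OF finX(1) bX] .
      finally have "card (X' e) \<le> card (X e)" if "e \<in> {1..n}" for e
        using other[of e] that card_mono[OF finX(1)] by (cases "e = d") auto
      then have "cost P' 1 n u \<le> cost P 1 n u"
        unfolding cost_u by (intro sum_mono) auto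
      then show ?thesis using u by blast
    next
      assume *: "2 \<le> d \<and> (\<forall>w. P (Suc b, d - 1) = Some w \<longrightarrow> y \<le> w)"
      then obtain c where c: "d = Suc c" "1 \<le> c" by (cases d) auto
      have * : "y \<le> w" if "P (Suc b, c) = Some w" for w using * that c by simp
      \<comment> \<open>Stay in column \<open>c\<close> up to the new value \<open>y\<close>: row by row, an entry of column \<open>c\<close> met in addition
        is paid for by its right neighbour, and row \<open>b\<close> pays for \<open>y\<close>.\<close>
      define u' where "u' = u(d := Suc y)"
      have ucd: "u c < u d" using u c d by (simp add: rising_def)
      have "rising 1 n u'"
        unfolding rising_def
      proof (intro allI impI)
        fix e assume e: "1 \<le> e \<and> e < n"
        then have "u e < u (Suc e)" using u by (simp add: rising_def)
        then show "u' e < u' (Suc e)" using b(4) e c by (auto simp: u'_def I)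
      qed
      moreover have "u' 1 = u 1" using c by (simp add: u'_def)
      moreover have "cost P' 1 n u' \<le> cost P 1 n u"
        unfolding cost_def
      proof (rule sum_le_pair[where d = c and e = d])
        fix e assume e: "e \<in> {1..n}" "e \<noteq> c" "e \<noteq> d"
        have "window u' n e = window u n e" using e c by (auto simp: window_def u'_def)
        then show "card (rows_in P' e (window u' n e)) \<le> card (rows_in P e (window u n e))"
          using other[of e] e card_mono[OF finX(1)] by (simp add: X_def X'_def I_def)
      next
        define Z where "Z = rows_in P c {w. u d \<le> Suc w \<and> w < y}"
        define Y where "Y = rows_in P' d (window u' n d)"
        have "rows_in P' c (window u' n c) \<subseteq> X c \<union> Z"
        proof
          fix i assume "i \<in> rows_in P' c (window u' n c)"
          then obtain w' where w': "P' (i, c) = Some w'" "u c \<le> w'" "w' < y"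
            using c d by (auto simp: rows_in_def window_def u'_def)
          obtain w where w: "P (i, c) = Some w" "w \<le> w'" using entry_grows[OF w'(1)] by auto
          have "w = w'"
          proof (rule ccontr)
            assume "w \<noteq> w'"
            then show False
              using staircase[of b d i c] b w w' c by auto
          qed
          then show "i \<in> X c \<union> Z" using w w' c by (auto simp: X_def Z_def rows_in_def I)
        qed
        moreover have "finite Z" by (simp add: Z_def fin_rows)
        ultimately have 1: "card (rows_in P' c (window u' n c)) \<le> card (X c) + card Z"
          using finX by (meson card_Un_le card_mono finite_UnI order_trans)
        have Zb: "i \<le> b \<and> i \<in> X d" if i: "i \<in> Z" for i
        proof -
          obtain w where w: "P (i, c) = Some w" "u d \<le> Suc w" "w < y"
            using i by (auto simp: Z_def rows_in_def)
          have ib: "i \<le> b"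
          proof (rule ccontr)
            assume ib: "\<not> i \<le> b"
            then obtain x where x: "P (Suc b, c) = Some x" using cell[OF w(1), of "Suc b" c] c by auto
            have "x \<le> w" using increasing_col_le[OF inc x w(1)] ib by simp
            then show False using *[OF x] w by simp
          qed
          obtain v where v: "P (i, d) = Some v"
            using cell[OF b(1), of i d] ib d index_pos[OF w(1)] by auto
          have "w < v" using increasing_row_less[OF inc w(1) v] c by simp
          moreover have "v \<le> m" using increasing_col_le[OF inc v b(1) ib] .
          ultimately have "v \<in> I d" using w my b(4) by (auto simp: I)
          then show ?thesis using ib v by (auto simp: X_def rows_in_def)
        qed
        have Yb: "b < i \<and> i \<in> X d" if i: "i \<in> Y" for i
        proof -
          obtain w' where w': "P' (i, d) = Some w'" "y < w'" "d < n \<longrightarrow> Suc w' < u (Suc d)"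
            using i by (auto simp: Y_def rows_in_def window_def u'_def)
          obtain w where w: "P (i, d) = Some w" "w \<le> w'" using entry_grows[OF w'(1)] by auto
          have "\<not> i < b" using col_le[OF _ _ b(1), of i] index_pos[OF w(1)] w' my by force
          then have bi: "b < i" using w' b by (metis less_irrefl nat_neq_iff option.inject)
          then have "y \<le> w" using col_le[OF b1 bi w(1)] b by auto
          then have "w \<in> I d" using b(4) w w' by (auto simp: I)
          then show ?thesis using bi w by (auto simp: X_def rows_in_def)
        qed
        have "Z \<inter> Y = {}" "Z \<union> Y \<subseteq> X d" using Zb Yb by fastforce+
        moreover have "finite Y" by (simp add: Y_def fin_rows)
        ultimately have "card Z + card Y \<le> card (X d)"
          using \<open>finite Z\<close> finX by (metis card_Un_disjoint card_mono)
        then show "card (rows_in P' c (window u' n c)) + card (rows_in P' d (window u' n d))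
            \<le> card (rows_in P c (window u n c)) + card (rows_in P d (window u n d))"
          using 1 by (simp add: Y_def X_def I_def)
      qed (use c d in auto)
      ultimately show ?thesis by blast
    qed
  qed
qed

text \<open>The mirror image of \<open>cost_decreases\<close>: the surplus now comes from an entry
  that leaves its window, by growth or by deletion. The second disjunct is the case of the last
  column; it records the value \<open>m\<close> at which a path prolonged to column
  \<open>Suc n\<close> can switch.\<close>

lemma cost_reflects:
  assumes n: "1 \<le> n" and u: "rising 1 n u"
  shows "(\<exists>u'. rising 1 n u' \<and> u' 1 = u 1 \<and> cost P 1 n u' \<le> cost P' 1 n u) \<or>
    (\<exists>i a m. P (i, n) \<noteq> None \<and> P' (i, n) = None \<and> P (a, n) = Some m \<and> u n \<le> m \<and>
      (a = 1 \<or> (\<exists>w\<le>m. P (a - 1, Suc n) = Some w)) \<and> cost P 1 n u \<le> Suc (cost P' 1 n u))"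
proof -
  define I where "I d = window u n d" for d
  define X where "X d = rows_in P d (I d)" for d
  define X' where "X' d = rows_in P' d (I d)" for d
  have finX: "finite (X d)" "finite (X' d)" for d using fin_rows by (auto simp: X_def X'_def)
  have I: "v \<in> I d \<longleftrightarrow> u d \<le> v \<and> (d < n \<longrightarrow> Suc v < u (Suc d))" for v d
    by (simp add: I_def window_def)
  have cost_u: "cost P 1 n u = (\<Sum>d = 1..n. card (X d))" "cost P' 1 n u = (\<Sum>d = 1..n. card (X' d))"
    by (simp_all add: cost_def I_def X_def X'_def)
  show ?thesis
  proof (cases "\<exists>d\<in>{1..n}. \<exists>i. i \<in> X d - X' d")
    case False
    then have "X d \<subseteq> X' d" if "d \<in> {1..n}" for d using that by blast
    then have "cost P 1 n u \<le> cost P' 1 n u"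
      unfolding cost_u using finX by (intro sum_mono card_mono) auto
    then show ?thesis using u by blast
  next
    case True
    then obtain i0 d where d: "1 \<le> d" "d \<le> n" and i0: "i0 \<in> X d" "i0 \<notin> X' d" by auto
    then obtain v0 where v0: "P (i0, d) = Some v0" "v0 \<in> I d" by (auto simp: X_def rows_in_def)
    have ch: "P' (i, e) \<noteq> P (i, e)" if "i \<in> X e" "i \<notin> X' e" for i e
      using that by (auto simp: X_def X'_def rows_in_def)
    have other: "X e \<subseteq> X' e" if e: "1 \<le> e" "e \<le> n" "e \<noteq> d" for e
    proof (rule ccontr)
      assume "\<not> X e \<subseteq> X' e"
      then obtain i where i: "i \<in> X e" "i \<notin> X' e" by auto
      then obtain w where w: "P (i, e) = Some w" "w \<in> I e" by (auto simp: X_def rows_in_def)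
      show False
      proof (cases "e < d")
        case True
        then obtain y where y: "P' (i0, d) = Some y" "y \<le> w"
          using staircase[OF ch[OF i0] ch[OF i]] w by auto
        have "v0 \<le> y" using entry_grows[OF y(1)] v0 by auto
        moreover have "u (Suc e) \<le> u d" using rising_less[OF u, of "Suc e" d] e d True
          by (cases "Suc e = d") auto
        ultimately show False using w v0 y True d by (simp add: I)
      next
        case False
        then obtain y where y: "P' (i, e) = Some y" "y \<le> v0"
          using staircase[OF ch[OF i] ch[OF i0]] v0 e by auto
        have "w \<le> y" using entry_grows[OF y(1)] w by auto
        moreover have "u (Suc d) \<le> u e" using rising_less[OF u, of "Suc d" e] e d False
          by (cases "Suc d = e") auto
        ultimately show False using w v0 y False d e by (simp add: I)
      qed
    qed
    have only: "i = i0" if i: "i \<in> X d" "i \<notin> X' d" for i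
    proof -
      obtain w where w: "P (i, d) = Some w" "w \<in> I d" using i by (auto simp: X_def rows_in_def)
      \<comment> \<open>Of two rows with old entries in the window, the upper one cannot leave it:
        its new entry is at most the old entry of the lower one.\<close>
      have aux: "j \<in> X' d" if jk: "P (j, d) = Some x" "x \<in> I d" "P (k, d) = Some z" "z \<in> I d" "j < k" for j k x z
      proof -
        obtain y where y: "P' (j, d) = Some y" "y \<le> z"
          using col_le[OF _ jk(5,3)] index_pos[OF jk(1)] by auto
        have "x \<le> y" using entry_grows[OF y(1)] jk(1) by auto
        then show ?thesis using y jk by (auto simp: X'_def rows_in_def I)
      qed
      show ?thesis using aux[OF w v0] aux[OF v0 w] i i0 by (metis nat_neq_iff)
    qed
    define S where "S = {a. \<exists>m. P (a, d) = Some m \<and> m \<in> I d \<and> P' (a, d) \<noteq> Some m}"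
    have i0S: "i0 \<in> S" using v0 ch[OF i0] by (auto simp: S_def)
    \<comment> \<open>By the choice of the topmost row, if \<open>m\<close> reappears in row
      \<open>a - 1\<close>, then that row was not counted before.\<close>
    define a where "a = (LEAST a. a \<in> S)"
    have "a \<in> S" using i0S unfolding a_def by (rule LeastI)
    then obtain m where a: "P (a, d) = Some m" "m \<in> I d" "P' (a, d) \<noteq> Some m" by (auto simp: S_def)
    have a_min: "a \<le> j" if "j \<in> S" for j unfolding a_def using that by (rule Least_le)
    have a1: "1 \<le> a" using index_pos[OF a(1)] by simp
    consider (shift) "a = 1 \<or> (\<exists>w\<le>m. P (a - 1, Suc d) = Some w)" | (cancel) "a \<noteq> 1" "P' (a - 1, d) = Some m"
      using right_exit[OF a(1,3)] by blast
    then show ?thesis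
    proof cases
      case cancel
      obtain m' where m': "P (a - 1, d) = Some m'" using entry_grows[OF cancel(2)] by auto
      have "m' < m" using increasing_col_less[OF inc m' a(1)] a1 cancel by simp
      have in': "a - 1 \<in> X' d" using cancel a by (auto simp: X'_def rows_in_def)
      have nin: "a - 1 \<notin> X d"
      proof
        assume "a - 1 \<in> X d"
        then have "a - 1 \<in> S" using m' cancel \<open>m' < m\<close> by (auto simp: S_def X_def rows_in_def)
        then show False using a_min[of "a - 1"] a1 by simp
      qed
      have "X d \<subseteq> insert i0 (X' d - {a - 1})" using only nin by blast
      then have "card (X d) \<le> card (insert i0 (X' d - {a - 1}))" using finX by (intro card_mono) auto
      also have "\<dots> \<le> Suc (card (X' d - {a - 1}))" by (simp add: card_insert_if finX)
      also have "\<dots> = card (X' d)" using card_Suc_Diff1[OF finX(2) in'] .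
      finally have "card (X e) \<le> card (X' e)" if "e \<in> {1..n}" for e
        using other[of e] that card_mono[OF finX(2)] by (cases "e = d") auto
      then have "cost P 1 n u \<le> cost P' 1 n u"
        unfolding cost_u by (intro sum_mono) auto
      then show ?thesis using u by blast
    next
      case shift
      show ?thesis
      proof (cases "d = n")
        case True
        \<comment> \<open>The last window is unbounded, so an entry cannot leave it by
          growing.\<close>
        have "P' (i0, n) = None"
        proof (rule ccontr)
          assume "P' (i0, n) \<noteq> None"
          then obtain y where y: "P' (i0, n) = Some y" by auto
          have "v0 \<le> y" using entry_grows[OF y] v0 True by auto
          then have "i0 \<in> X' d" using y v0 True by (auto simp: X'_def rows_in_def I)
          then show False using i0 by simp
        qed
        moreover have "cost P 1 n u \<le> Suc (cost P' 1 n u)"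
        proof -
          have "X d \<subseteq> insert i0 (X' d)" using only by blast
          then have "card (X d) \<le> Suc (card (X' d))"
            using card_mono[of "insert i0 (X' d)" "X d"] i0 finX by simp
          moreover have "(\<Sum>e\<in>{1..n} - {d}. card (X e)) \<le> (\<Sum>e\<in>{1..n} - {d}. card (X' e))"
            using other finX by (intro sum_mono card_mono) auto
          moreover have "cost P 1 n u = card (X d) + (\<Sum>e\<in>{1..n} - {d}. card (X e))"
            "cost P' 1 n u = card (X' d) + (\<Sum>e\<in>{1..n} - {d}. card (X' e))"
            unfolding cost_u using d by (auto intro!: sum.remove)
          ultimately show ?thesis by simp
        qed
        moreover have "u n \<le> m" using a True by (simp add: I)
        ultimately show ?thesis using v0 a shift True by blast
      next
        case False
        then have dn: "Suc d \<le> n" using d by simp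
        \<comment> \<open>Leave column \<open>d\<close> already at the old value \<open>m\<close>: row by row, an entry of column \<open>d + 1\<close> met in
          addition is paid for by its left neighbour in \<open>P'\<close>.\<close>
        define u' where "u' = u(Suc d := Suc m)"
        have mI: "u d \<le> m" "Suc m < u (Suc d)" using a dn by (auto simp: I)
        have "rising 1 n u'"
          unfolding rising_def
        proof (intro allI impI)
          fix e assume e: "1 \<le> e \<and> e < n"
          then have "u e < u (Suc e)" using u by (simp add: rising_def)
          then show "u' e < u' (Suc e)" using mI e by (auto simp: u'_def)
        qed
        moreover have "u' 1 = u 1" using d by (simp add: u'_def)
        moreover have "cost P 1 n u' \<le> cost P' 1 n u"
          unfolding cost_def
        proof (rule sum_le_pair[where d = d and e = "Suc d"])
          fix e assume e: "e \<in> {1..n}" "e \<noteq> d" "e \<noteq> Suc d"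
          have "window u' n e = window u n e" using e by (auto simp: window_def u'_def)
          then show "card (rows_in P e (window u' n e)) \<le> card (rows_in P' e (window u n e))"
            using other[of e] e card_mono[OF finX(2)] by (simp add: X_def X'_def I_def)
        next
          define Y where "Y = rows_in P d (window u' n d)"
          define Z where "Z = rows_in P (Suc d) {v. m < v \<and> v < u (Suc d)}"
          have finYZ: "finite Y" "finite Z" by (simp_all add: Y_def Z_def fin_rows)
          have row_ge: "a \<le> i" if "P (i, Suc d) = Some v" "m < v" for i v
          proof (rule ccontr)
            assume "\<not> a \<le> i"
            moreover have "1 \<le> i" using index_pos[OF that(1)] by simp
            ultimately obtain w where w: "P (a - 1, Suc d) = Some w" "w \<le> m" using shift by auto
            have "v \<le> w" using increasing_col_le[OF inc that(1) w(1)] \<open>\<not> a \<le> i\<close> by simp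
            then show False using that w by simp
          qed
          have Ya: "i < a \<and> i \<in> X' d" if i: "i \<in> Y" for i
          proof -
            obtain v where v: "P (i, d) = Some v" "u d \<le> v" "v < m"
              using i dn by (auto simp: Y_def rows_in_def window_def u'_def)
            have ia: "i < a" using increasing_col_less_iff[OF inc v(1) a(1)] v by simp
            then obtain y where y: "P' (i, d) = Some y" "y \<le> m"
              using col_le[OF _ ia a(1)] index_pos[OF v(1)] by auto
            have "v \<le> y" using entry_grows[OF y(1)] v by auto
            then have "y \<in> I d" using y v mI by (simp add: I)
            then show ?thesis using ia y by (auto simp: X'_def rows_in_def)
          qed
          have Za: "a \<le> i \<and> i \<in> X' d" if i: "i \<in> Z" for i
          proof -
            obtain v where v: "P (i, Suc d) = Some v" "m < v" "v < u (Suc d)"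
              using i by (auto simp: Z_def rows_in_def)
            have ai: "a \<le> i" using row_ge v by blast
            obtain y where y: "P' (i, d) = Some y" "y < v" using row_less[OF d(1) v(1)] by auto
            obtain w where w: "P (i, d) = Some w" "w \<le> y" using entry_grows[OF y(1)] by auto
            have "m \<le> w" using increasing_col_le[OF inc a(1) w(1) ai] .
            then have "y \<in> I d" using y v mI w by (simp add: I)
            then show ?thesis using ai y by (auto simp: X'_def rows_in_def)
          qed
          have "rows_in P (Suc d) (window u' n (Suc d)) \<subseteq> X' (Suc d) \<union> Z"
          proof
            fix i assume "i \<in> rows_in P (Suc d) (window u' n (Suc d))"
            then obtain v where v: "P (i, Suc d) = Some v" "m < v" "Suc d < n \<longrightarrow> Suc v < u (Suc (Suc d))"
              by (auto simp: rows_in_def window_def u'_def)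
            have "P' (i, Suc d) = P (i, Suc d)"
              using staircase[of i "Suc d" a d] a row_ge[OF v(1,2)] by force
            then show "i \<in> X' (Suc d) \<union> Z" using v by (auto simp: X'_def Z_def rows_in_def I)
          qed
          then have "card (rows_in P (Suc d) (window u' n (Suc d))) \<le> card (X' (Suc d)) + card Z"
            using finX finYZ by (meson card_Un_le card_mono finite_UnI order_trans)
          moreover have "Y \<inter> Z = {}" "Y \<union> Z \<subseteq> X' d" using Ya Za by fastforce+
          then have "card Y + card Z \<le> card (X' d)"
            using finYZ finX by (metis card_Un_disjoint card_mono)
          ultimately show "card (rows_in P d (window u' n d)) + card (rows_in P (Suc d) (window u' n (Suc d)))
            \<le> card (rows_in P' d (window u n d)) + card (rows_in P' (Suc d) (window u n (Suc d)))"
            by (simp add: Y_def X'_def I_def)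
        qed (use d dn in auto)
        ultimately show ?thesis by blast
      qed
    qed
  qed
qed

end

section \<open>Comparison of the key columns of the two tableaux\<close>

lemma eq_if_card_atLeast_eq:
  fixes A B :: "nat set"
  assumes "finite A" "finite B" "\<And>k. card (A \<inter> {k..}) = card (B \<inter> {k..})"
  shows "A = B"
proof (rule set_eqI)
  fix k
  show "k \<in> A \<longleftrightarrow> k \<in> B"
    using card_atLeast_step[OF assms(1), of k] card_atLeast_step[OF assms(2), of k]
      assms(3)[of k] assms(3)[of "Suc k"] by (auto split: if_splits)
qed

text \<open>Heights stand in for the sizes of key columns so that the bound applies to
  \<open>P'\<close>, for which the exchange supplies the row condition.\<close>

lemma passage_extend:
  assumes Q: "finite (dom Q)" "column_injective Q"
    and row: "\<And>i w. Q (i, Suc n) = Some w \<Longrightarrow> \<exists>y<w. Q (i, n) = Some y"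
    and n: "1 \<le> n"
  shows "passage Q n k + height Q (Suc n) \<le> passage Q (Suc n) k + height Q n"
proof -
  obtain u where u: "rising 1 (Suc n) u" "u 1 = k" "passage Q (Suc n) k = cost Q 1 (Suc n) u"
    using passage_attained[OF Q] by (metis le_add1 plus_1_eq_Suc)
  have "rising 1 n u" using u by (simp add: rising_def)
  then have "passage Q n k \<le> cost Q 1 n u" using passage_le_cost[OF Q n] u(2) by metis
  then show ?thesis using cost_extend[OF Q(1) row n, of u] u by simp
qed

lemma key_col_Suc_subset:
  assumes "finite (dom P)" "1 \<le> n"
  shows "key_col P (Suc n) \<subseteq> key_col P n"
  using nest_Suc_subset[OF assms(1), of 1 "n - 1"] assms(2) by (simp add: key_col_def)

context tableau_exchange
begin

lemma passage_le:
  assumes n: "1 \<le> n"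
  shows "passage P' n k \<le> passage P n k"
proof -
  obtain u where u: "rising 1 n u" "u 1 = k" "passage P n k = cost P 1 n u"
    using passage_attained[OF fin inj n] by blast
  obtain u' where "rising 1 n u'" "u' 1 = k" "cost P' 1 n u' \<le> cost P 1 n u"
    using cost_decreases[OF n u(1)] u(2) by auto
  then show ?thesis using passage_le_cost[OF fin' inj' n, of u'] u(3) by simp
qed

text \<open>If no cell of column \<open>n\<close> is deleted, the exceptional case of
  \<open>cost_reflects\<close> cannot arise.\<close>

lemma key_col_eq:
  assumes n: "1 \<le> n" and kept: "\<And>i. P (i, n) \<noteq> None \<Longrightarrow> P' (i, n) \<noteq> None"
  shows "key_col P' n = key_col P n"
proof (rule eq_if_card_atLeast_eq)
  fix k
  obtain u where u: "rising 1 n u" "u 1 = k" "passage P' n k = cost P' 1 n u"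
    using passage_attained[OF fin' inj' n] by blast
  obtain u' where "rising 1 n u'" "u' 1 = k" "cost P 1 n u' \<le> cost P' 1 n u"
    using cost_reflects[OF n u(1)] u(2) kept by blast
  then have "passage P n k \<le> passage P' n k" using passage_le_cost[OF fin inj n, of u'] u(3) by simp
  then show "passage P' n k = passage P n k" using passage_le[OF n, of k] by simp
qed (simp_all add: finite_key_col fin fin')

text \<open>Let A and B be the key columns \<open>C\<close> and \<open>Suc C\<close> of
  \<open>P\<close>. The bounds \<open>passage_le\<close>, \<open>up\<close> and \<open>down\<close>
  make \<open>passage P' C k\<close> the minimum of \<open>passage P C k\<close> and
  \<open>passage P (Suc C) k + card (A - B) - 1\<close>. The second number is smaller, and then by
  one, exactly when all of A - B is at least \<open>k\<close>, that is, for \<open>k\<close> up to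
  its minimum.\<close>

lemma key_col_deleted:
  assumes RC: "P (R, C) \<noteq> None" "P (Suc R, C) = None" "P (R, Suc C) = None"
    and del: "P' (R, C) = None"
    and kept: "\<And>i d. P (i, d) \<noteq> None \<Longrightarrow> (i, d) \<noteq> (R, C) \<Longrightarrow> P' (i, d) \<noteq> None"
  shows "key_col P' C = key_col P C - {Min (key_col P C - key_col P (Suc C))}"
    and "rows_in P' C UNIV = {1..card (key_col P' C)}"
proof -
  obtain e where e: "P (R, C) = Some e" using RC by auto
  have pos: "1 \<le> R" "1 \<le> C" using index_pos[OF e] by auto
  have rowsC: "rows_in P C UNIV = {1..height P C}" and rowsC1: "rows_in P (Suc C) UNIV = {1..height P (Suc C)}"
    using increasing_rows_in_UNIV[OF inc] by auto
  have "R \<in> {1..height P C}" "Suc R \<notin> {1..height P C}" "R \<notin> {1..height P (Suc C)}"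
    unfolding rowsC[symmetric] rowsC1[symmetric] using RC by (auto simp: rows_in_def)
  then have hC: "height P C = R" and hC1: "height P (Suc C) < R" using pos by auto
  have dom_iff: "P' (i, d) \<noteq> None \<longleftrightarrow> P (i, d) \<noteq> None \<and> (i, d) \<noteq> (R, C)" for i d
    using kept[of i d] del dom_subset by (auto simp: dom_def)
  have "rows_in P' C UNIV = rows_in P C UNIV - {R}"
    unfolding rows_in_UNIV by (auto simp: dom_iff simp del: not_None_eq)
  then have rowsC': "rows_in P' C UNIV = {1..R} - {R}" using rowsC hC by simp
  then have hC': "height P' C = R - 1" using pos by (simp add: height_def)
  have "rows_in P' (Suc C) UNIV = rows_in P (Suc C) UNIV"
    unfolding rows_in_UNIV by (auto simp: dom_iff simp del: not_None_eq)
  then have hC1': "height P' (Suc C) = height P (Suc C)" by (simp add: height_def)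
  let ?A = "key_col P C" and ?B = "key_col P (Suc C)"
  have finAB: "finite ?A" "finite ?B" by (simp_all add: finite_key_col fin)
  have BA: "?B \<subseteq> ?A" using key_col_Suc_subset[OF fin pos(2)] .
  have cards: "card ?A = R" "card ?B = height P (Suc C)"
    using card_key_col[OF inc] pos hC by auto
  define x where "x = Min (?A - ?B)"
  have ne: "?A - ?B \<noteq> {}" using cards hC1 BA by (metis Diff_eq_empty_iff less_irrefl subset_antisym)
  have x: "x \<in> ?A - ?B" unfolding x_def using finAB ne by (intro Min_in) auto
  have "passage P' C k = card ((?A - {x}) \<inter> {k..})" for k
  proof -
    \<comment> \<open>A path to column \<open>Suc C\<close>, whose key is unchanged, is cut back to
      column \<open>C\<close>, whose height has dropped by one.\<close>
    have up: "passage P' C k + height P (Suc C) + 1 \<le> passage P (Suc C) k + R"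
    proof -
      have "\<exists>y<w. P' (i, C) = Some y" if w: "P' (i, Suc C) = Some w" for i w
      proof -
        obtain v where v: "v \<le> w" "P (i, Suc C) = Some v" using entry_grows[OF w] by auto
        then show ?thesis using row_less[OF pos(2) v(2)] by (meson less_le_trans)
      qed
      then have "passage P' C k + height P' (Suc C) \<le> passage P' (Suc C) k + height P' C"
        by (intro passage_extend fin' inj' pos)
      moreover have "passage P' (Suc C) k = passage P (Suc C) k"
        using key_col_eq[of "Suc C"] kept by simp
      ultimately show ?thesis using hC' hC1' pos by simp
    qed
    have down: "passage P C k \<le> passage P' C k \<or>
      passage P C k \<le> Suc (passage P' C k) \<and>
      passage P (Suc C) k + R \<le> Suc (passage P' C k) + height P (Suc C)"
    proof -
      obtain u where u: "rising 1 C u" "u 1 = k" "passage P' C k = cost P' 1 C u"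
        using passage_attained[OF fin' inj' pos(2)] by blast
      from cost_reflects[OF pos(2) u(1)] show ?thesis
      proof
        assume "\<exists>u'. rising 1 C u' \<and> u' 1 = u 1 \<and> cost P 1 C u' \<le> cost P' 1 C u"
        then obtain u' where "rising 1 C u'" "u' 1 = k" "cost P 1 C u' \<le> cost P' 1 C u"
          using u(2) by auto
        then show ?thesis using passage_le_cost[OF fin inj pos(2), of u'] u(3) by simp
      next
        assume "\<exists>i a m. P (i, C) \<noteq> None \<and> P' (i, C) = None \<and> P (a, C) = Some m \<and> u C \<le> m \<and>
          (a = 1 \<or> (\<exists>w\<le>m. P (a - 1, Suc C) = Some w)) \<and> cost P 1 C u \<le> Suc (cost P' 1 C u)"
        then obtain a m where a: "P (a, C) = Some m" "u C \<le> m"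
          "a = 1 \<or> (\<exists>w\<le>m. P (a - 1, Suc C) = Some w)" and cost: "cost P 1 C u \<le> Suc (cost P' 1 C u)"
          by auto
        have aR: "1 \<le> a" "a \<le> R"
        proof -
          have "a \<in> rows_in P C UNIV" using a by (auto simp: rows_in_def)
          then show "1 \<le> a" "a \<le> R" using rowsC hC by auto
        qed
        have aH: "a \<le> Suc (height P (Suc C))"
        proof (cases "a = 1")
          case False
          then have "a - 1 \<in> rows_in P (Suc C) UNIV" using a by (auto simp: rows_in_def)
          then show ?thesis using rowsC1 by auto
        qed simp
        \<comment> \<open>The path is prolonged to column \<open>Suc C\<close>, switching at the
          value \<open>m\<close> recorded in the exceptional case.\<close>
        define u' where "u' = u(Suc C := Suc m)"
        have u': "rising 1 (Suc C) u'"
          using u(1) a(2) by (auto simp: rising_def u'_def less_Suc_eq)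
        have "passage P (Suc C) k \<le> cost P 1 (Suc C) u'"
          using passage_le_cost[OF fin inj _ u'] u(2) pos by (simp add: u'_def)
        \<comment> \<open>Rows \<open>a\<close> to \<open>R\<close> of column \<open>C\<close> are
          no longer paid for, and the rows newly paid for in column \<open>Suc C\<close> lie between
          \<open>a\<close> and its height. By \<open>aR\<close> and \<open>aH\<close> the truncated
          subtractions are exact.\<close>
        moreover have "cost P 1 (Suc C) u' + R \<le> cost P 1 C u + height P (Suc C)"
        proof -
          define Y where "Y = rows_in P C {v. u C \<le> v \<and> v < m}"
          have "(\<Sum>d = 1..<C. card (rows_in P d (window u' (Suc C) d))) = (\<Sum>d = 1..<C. card (rows_in P d (window u C d)))"
            by (intro sum.cong) (auto simp: window_def u'_def)
          moreover have "{1..C} = insert C {1..<C}" "{1..Suc C} = insert (Suc C) (insert C {1..<C})"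
            using pos by auto
          ultimately have "cost P 1 (Suc C) u' + card (rows_in P C {u C..}) =
            cost P 1 C u + card Y + card (rows_in P (Suc C) {Suc m..})"
            by (auto simp: cost_def window_def u'_def atLeast_def Y_def)
          moreover have "card Y + (Suc R - a) \<le> card (rows_in P C {u C..})"
          proof -
            have "Y \<inter> {a..R} = {}"
              using increasing_col_le[OF inc a(1)] by (fastforce simp: Y_def rows_in_def)
            moreover have "{a..R} \<subseteq> rows_in P C {u C..}"
            proof
              fix i assume i: "i \<in> {a..R}"
              then have "i \<in> rows_in P C UNIV" using rowsC hC aR by auto
              then obtain v where v: "P (i, C) = Some v" by (auto simp: rows_in_def)
              then have "m \<le> v" using increasing_col_le[OF inc a(1) v] i by simp
              then show "i \<in> rows_in P C {u C..}" using v a by (auto simp: rows_in_def)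
            qed
            then have "Y \<union> {a..R} \<subseteq> rows_in P C {u C..}" by (auto simp: Y_def rows_in_def)
            moreover have "finite Y" by (simp add: Y_def fin_rows)
            ultimately show ?thesis
              using card_mono[OF fin_rows(1), of "Y \<union> {a..R}" C "{u C..}"] by (simp add: card_Un_disjoint)
          qed
          moreover have "card (rows_in P (Suc C) {Suc m..}) \<le> Suc (height P (Suc C)) - a"
          proof -
            have "rows_in P (Suc C) {Suc m..} \<subseteq> {a..height P (Suc C)}"
            proof
              fix i assume "i \<in> rows_in P (Suc C) {Suc m..}"
              then obtain v where v: "P (i, Suc C) = Some v" "m < v" by (auto simp: rows_in_def)
              then have "i \<in> rows_in P (Suc C) UNIV" by (auto simp: rows_in_def)
              then have i: "1 \<le> i" "i \<le> height P (Suc C)" using rowsC1 by auto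
              have "a \<le> i"
              proof (rule ccontr)
                assume "\<not> a \<le> i"
                then obtain w where w: "P (a - 1, Suc C) = Some w" "w \<le> m" using a(3) i by auto
                have "v \<le> w" using increasing_col_le[OF inc v(1) w(1)] \<open>\<not> a \<le> i\<close> by simp
                then show False using v w by simp
              qed
              then show "i \<in> {a..height P (Suc C)}" using i by simp
            qed
            then show ?thesis using card_mono[of "{a..height P (Suc C)}"] by fastforce
          qed
          ultimately show ?thesis using aR aH by linarith
        qed
        moreover have "passage P C k \<le> cost P 1 C u" using passage_le_cost[OF fin inj pos(2) u(1)] u(2) by simp
        ultimately show ?thesis using cost u(3) by linarith
      qed
    qed
    have diff: "passage P C k = passage P (Suc C) k + card ((?A - ?B) \<inter> {k..})"
    proof -
      have "?A \<inter> {k..} = (?B \<inter> {k..}) \<union> ((?A - ?B) \<inter> {k..})" using BA by auto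
      then show ?thesis using finAB by (simp, subst card_Un_disjoint) auto
    qed
    have cAB: "card (?A - ?B) + height P (Suc C) = R"
      using card_Diff_subset[OF finAB(2) BA] cards hC1 by simp
    have Mx: "x \<le> z" if "z \<in> ?A - ?B" for z unfolding x_def using that finAB by (intro Min_le) auto
    show ?thesis
    proof (cases "k \<le> x")
      case True
      then have "(?A - ?B) \<inter> {k..} = ?A - ?B" using Mx by fastforce
      then have "passage P C k = Suc (passage P' C k)"
        using diff cAB up down passage_le[OF pos(2), of k] by auto
      moreover have "?A \<inter> {k..} = insert x ((?A - {x}) \<inter> {k..})" using x True by auto
      then have "passage P C k = Suc (card ((?A - {x}) \<inter> {k..}))" using finAB by simp
      ultimately show ?thesis by simp
    next
      case False
      then have "(?A - ?B) \<inter> {k..} \<subset> ?A - ?B" using x by auto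
      then have "card ((?A - ?B) \<inter> {k..}) < card (?A - ?B)" using finAB by (intro psubset_card_mono) auto
      then have "passage P' C k = passage P C k"
        using diff cAB down passage_le[OF pos(2), of k] by auto
      moreover have "?A \<inter> {k..} = (?A - {x}) \<inter> {k..}" using False by auto
      ultimately show ?thesis by simp
    qed
  qed
  then have "key_col P' C = ?A - {x}"
    using finAB fin' by (intro eq_if_card_atLeast_eq) (auto simp: finite_key_col)
  moreover from this have "card (key_col P' C) = R - 1" using x cards finAB by simp
  then have "rows_in P' C UNIV = {1..card (key_col P' C)}" unfolding rowsC' by auto
  ultimately show "key_col P' C = ?A - {Min (?A - ?B)}" "rows_in P' C UNIV = {1..card (key_col P' C)}"
    by (simp_all add: x_def)
qed

end

section \<open>Reverse row insertion\<close>

text \<open>The disjuncts are the cases (D), (DR), (IR) and (NR). Ejectability and maximality of the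
  replacing value are dropped; only its presence in the row below matters for the key.\<close>

definition row_step :: "tableau \<Rightarrow> tableau \<Rightarrow> nat \<Rightarrow> nat \<Rightarrow> nat \<Rightarrow> enat \<Rightarrow> bool \<Rightarrow> bool \<Rightarrow> bool" where
  "row_step P Q i ci mi mnext a a' \<longleftrightarrow>
     mi + 1 \<in> row_set P i \<and> Q (i, ci) = P (i, ci) \<and> a' = a \<or>
     a \<and> mnext \<notin> enat ` row_set P i \<and> Q (i, ci) = Some (the_enat mnext) \<and> a' \<or>
     \<not> (a \<and> mnext \<notin> enat ` row_set P i) \<and>
       ((\<exists>x\<in>row_set Q (i + 1). mi < x \<and> enat x < mnext \<and> Q (i, ci) = Some x \<and> a') \<or>
        Q (i, ci) = P (i, ci) \<and> \<not> a')"

text \<open>A step at row \<open>i\<close> concerns rows \<open>i\<close> and \<open>Suc i\<close>,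
  and later steps change only rows above; so the intermediate tableau can be replaced by the
  output.\<close>

lemma row_step_cong:
  assumes "\<And>j. Q (i, j) = Q' (i, j)" "\<And>j. Q (Suc i, j) = Q' (Suc i, j)"
  shows "row_step P Q i ci mi mnext a a' = row_step P Q' i ci mi mnext a a'"
  using assms by (simp add: row_step_def row_set_def)

lemma ejectable_in_row: "ejectable T k x \<Longrightarrow> x \<in> row_set T k"
  by (auto elim: ejectable.cases)

lemma finite_row_set: "finite (dom P) \<Longrightarrow> finite (row_set P i)"
proof -
  assume "finite (dom P)"
  moreover have "row_set P i \<subseteq> (the \<circ> P) ` dom P" by (force simp: row_set_def)
  ultimately show ?thesis by (meson finite_imageI finite_subset)
qed

lemma rri_step_row_step:
  assumes fin: "finite (dom Q)" and agree: "\<And>j. Q (i, j) = P (i, j)"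
    and step: "rri_step P Q i ci mi mnext a = (Q', a')"
  shows "row_step P Q' i ci mi mnext a a'" "\<And>z. z \<noteq> (i, ci) \<Longrightarrow> Q' z = Q z" "finite (dom Q')"
proof -
  define X where "X = {x. ejectable Q (i + 1) x \<and> mi < x \<and> enat x < mnext}"
  have "X \<subseteq> row_set Q (i + 1)" by (auto simp: X_def ejectable_in_row)
  then have finX: "finite X" using finite_row_set[OF fin] finite_subset by blast
  consider (D) "mi + 1 \<in> row_set P i" "Q' = Q" "a' = a"
    | (DR) "mi + 1 \<notin> row_set P i" "a" "mnext \<notin> enat ` row_set P i"
        "Q' = Q((i, ci) := Some (the_enat mnext))" "a'"
    | (IR) "mi + 1 \<notin> row_set P i" "\<not> (a \<and> mnext \<notin> enat ` row_set P i)" "X \<noteq> {}"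
        "Q' = Q((i, ci) := Some (Max X))" "a'"
    | (NR) "mi + 1 \<notin> row_set P i" "\<not> (a \<and> mnext \<notin> enat ` row_set P i)" "Q' = Q" "\<not> a'"
    using step unfolding rri_step_def Let_def X_def[symmetric] by (auto split: if_splits)
  note cases = this
  from cases show "row_step P Q' i ci mi mnext a a'"
  proof cases
    case IR
    have "Max X \<in> X" using Max_in[OF finX IR(3)] .
    then have "mi < Max X" "enat (Max X) < mnext" "Max X \<in> row_set Q (i + 1)"
      by (auto simp: X_def ejectable_in_row)
    moreover have "row_set Q' (i + 1) = row_set Q (i + 1)" using IR by (simp add: row_set_def)
    ultimately show ?thesis using IR by (auto simp: row_step_def)
  qed (auto simp: row_step_def agree)
  from cases show "Q' z = Q z" if "z \<noteq> (i, ci)" for z using that by cases auto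
  from cases show "finite (dom Q')" using fin by cases auto
qed

text \<open>Turns the loop into a static statement about the output, with all flags in one function.
  The induction peels off the bottom row \<open>Suc n\<close>, which is treated first, while the
  rows above still agree with \<open>P\<close>.\<close>

lemma rri_loop_row_step:
  assumes "n \<le> r" "finite (dom Q)" "\<And>i j. i \<le> n \<Longrightarrow> Q (i, j) = P (i, j)"
    and "rri_loop P r c n (Q, a) = (P', a')"
  shows "\<exists>\<alpha>. \<alpha> (Suc n) = a \<and>
    (\<forall>i j. \<not> (1 \<le> i \<and> i \<le> n \<and> j = bcol P r c (r - i)) \<longrightarrow> P' (i, j) = Q (i, j)) \<and>
    (\<forall>i. 1 \<le> i \<and> i \<le> n \<longrightarrow> row_step P P' i (bcol P r c (r - i)) (bm P r c i)
       (if i = r then \<infinity> else enat (bm P r c (Suc i))) (\<alpha> (Suc i)) (\<alpha> i))"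
  using assms
proof (induction n arbitrary: Q a)
  case 0
  then show ?case by (intro exI[of _ "\<lambda>_. a"]) auto
next
  case (Suc n)
  define ci where "ci = bcol P r c (r - Suc n)"
  define mn where "mn = (if Suc n = r then \<infinity> else enat (bm P r c (Suc (Suc n))))"
  obtain Q1 a1 where Q1: "rri_step P Q (Suc n) ci (bm P r c (Suc n)) mn a = (Q1, a1)" by fastforce
  note s = rri_step_row_step[OF Suc.prems(2) _ Q1]
  have agree: "\<And>j. Q (Suc n, j) = P (Suc n, j)" using Suc.prems(3) by simp
  have loop: "rri_loop P r c n (Q1, a1) = (P', a')"
    using Suc.prems(4) Q1 by (simp add: ci_def mn_def cong: if_cong)
  have Q1_lo: "Q1 (i, j) = P (i, j)" if "i \<le> n" for i j using s(2)[OF agree] Suc.prems(3) that by auto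
  obtain \<alpha> where \<alpha>: "\<alpha> (Suc n) = a1"
    "\<And>i j. \<not> (1 \<le> i \<and> i \<le> n \<and> j = bcol P r c (r - i)) \<Longrightarrow> P' (i, j) = Q1 (i, j)"
    "\<And>i. 1 \<le> i \<Longrightarrow> i \<le> n \<Longrightarrow> row_step P P' i (bcol P r c (r - i)) (bm P r c i)
       (if i = r then \<infinity> else enat (bm P r c (Suc i))) (\<alpha> (Suc i)) (\<alpha> i)"
    using Suc.IH[OF _ s(3)[OF agree] Q1_lo loop] Suc.prems(1) by auto
  define \<beta> where "\<beta> = \<alpha>(Suc (Suc n) := a)"
  have hi: "P' (i, j) = Q1 (i, j)" if "n < i" for i j using \<alpha>(2) that by simp
  have "row_step P Q1 (Suc n) ci (bm P r c (Suc n)) mn a a1" using s(1)[OF agree] .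
  then have top: "row_step P P' (Suc n) ci (bm P r c (Suc n)) mn a a1"
    using hi row_step_cong[of P' "Suc n" Q1] by simp
  show ?case
  proof (intro exI[of _ \<beta>] conjI allI impI)
    show "\<beta> (Suc (Suc n)) = a" by (simp add: \<beta>_def)
  next
    fix i j assume *: "\<not> (1 \<le> i \<and> i \<le> Suc n \<and> j = bcol P r c (r - i))"
    then have "P' (i, j) = Q1 (i, j)" by (intro \<alpha>(2)) auto
    moreover have "Q1 (i, j) = Q (i, j)" using * by (intro s(2)[OF agree]) (auto simp: ci_def)
    ultimately show "P' (i, j) = Q (i, j)" by simp
  next
    fix i assume i: "1 \<le> i \<and> i \<le> Suc n"
    show "row_step P P' i (bcol P r c (r - i)) (bm P r c i)
       (if i = r then \<infinity> else enat (bm P r c (Suc i))) (\<beta> (Suc i)) (\<beta> i)"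
    proof (cases "i = Suc n")
      case True
      have "\<beta> (Suc (Suc n)) = a" "\<beta> (Suc n) = a1" using \<alpha>(1) by (simp_all add: \<beta>_def)
      then show ?thesis using top unfolding ci_def mn_def True by (simp only:)
    next
      case False
      then show ?thesis using \<alpha>(3)[of i] i by (simp add: \<beta>_def)
    qed
  qed
qed

text \<open>Row \<open>R\<close> is kept apart since the loop can start in two ways: its cell is
  deleted and the flag is raised, or it takes an ordinary step with an infinite value and the flag
  \<open>False\<close> coming from below.\<close>

locale reverse_bumping =
  fixes P P' :: tableau and R C :: nat and c m :: "nat \<Rightarrow> nat" and \<alpha> :: "nat \<Rightarrow> bool" and del :: bool
  assumes inc: "increasing_tableau P"
    and outer: "P (Suc R, C) = None" "P (R, Suc C) = None"
    and R: "1 \<le> R" and cR: "c R = C"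
    and path: "1 \<le> i \<Longrightarrow> i \<le> R \<Longrightarrow> P (i, c i) = Some (m i)"
    and c_le: "1 \<le> i \<Longrightarrow> i < R \<Longrightarrow> c (Suc i) \<le> c i"
    and m_less: "1 \<le> i \<Longrightarrow> i < R \<Longrightarrow> m i < m (Suc i)"
    and path_max: "1 \<le> i \<Longrightarrow> i < R \<Longrightarrow> P (i, j) = Some v \<Longrightarrow> c i < j \<Longrightarrow> m (Suc i) \<le> v"
    and off_path: "\<not> (1 \<le> i \<and> i \<le> R \<and> j = c i) \<Longrightarrow> P' (i, j) = P (i, j)"
    and step: "1 \<le> i \<Longrightarrow> i < R \<Longrightarrow>
      row_step P P' i (c i) (m i) (enat (m (Suc i))) (\<alpha> (Suc i)) (\<alpha> i)"
    and last_del: "del \<Longrightarrow> P' (R, C) = None \<and> \<alpha> R"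
    and last_step: "\<not> del \<Longrightarrow> row_step P P' R C (m R) \<infinity> False (\<alpha> R)"
begin

lemma c_antimono: "i \<le> j \<Longrightarrow> 1 \<le> i \<Longrightarrow> j \<le> R \<Longrightarrow> c j \<le> c i"
proof (induction j rule: dec_induct)
  case (step n)
  then show ?case using c_le[of n] by simp
qed simp

lemma m_mono: "i \<le> j \<Longrightarrow> 1 \<le> i \<Longrightarrow> j \<le> R \<Longrightarrow> m i \<le> m j"
proof (induction j rule: dec_induct)
  case (step n)
  then show ?case using m_less[of n] by simp
qed simp

lemma row_succ_beyond:
  assumes "1 \<le> i" "i \<le> R" "v \<in> row_set P i" "m i < v"
  shows "\<exists>w\<le>v. P (i, Suc (c i)) = Some w"
proof -
  obtain f where f: "P (i, f) = Some v" using assms by (auto simp: row_set_def)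
  have "c i < f" using increasing_row_less_iff[OF inc path[OF assms(1,2)] f] assms by simp
  then obtain w where w: "P (i, Suc (c i)) = Some w"
    using increasing_cell[OF inc f, of i "Suc (c i)"] assms by auto
  then show ?thesis using increasing_row_le[OF inc w f] \<open>c i < f\<close> by auto
qed

text \<open>In an undeleted bottom row the incoming flag is \<open>False\<close>, which excludes
  (DR) and leaves (IR) as the only source of a raised flag.\<close>

lemma row_cases:
  assumes "1 \<le> i" "i \<le> R" "\<not> (del \<and> i = R)"
  obtains (D) "m i + 1 \<in> row_set P i" "P' (i, c i) = Some (m i)" "\<alpha> i \<longrightarrow> i < R \<and> \<alpha> (Suc i)"
  | (DR) "i < R" "\<alpha> (Suc i)" "m (Suc i) \<notin> row_set P i" "P' (i, c i) = Some (m (Suc i))" "\<alpha> i"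
  | (IR) x where "i < R \<Longrightarrow> \<alpha> (Suc i) \<Longrightarrow> m (Suc i) \<in> row_set P i" "x \<in> row_set P' (Suc i)" "m i < x"
      "i < R \<longrightarrow> x < m (Suc i)" "P' (i, c i) = Some x" "\<alpha> i"
  | (NR) "i < R \<Longrightarrow> \<alpha> (Suc i) \<Longrightarrow> m (Suc i) \<in> row_set P i" "P' (i, c i) = Some (m i)" "\<not> \<alpha> i"
proof (cases "i < R")
  case True
  have mem: "enat v \<in> enat ` A \<longleftrightarrow> v \<in> A" for v A by auto
  consider "m i + 1 \<in> row_set P i" "P' (i, c i) = P (i, c i)" "\<alpha> i = \<alpha> (Suc i)"
    | "\<alpha> (Suc i)" "m (Suc i) \<notin> row_set P i" "P' (i, c i) = Some (m (Suc i))" "\<alpha> i"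
    | x where "\<not> (\<alpha> (Suc i) \<and> m (Suc i) \<notin> row_set P i)" "x \<in> row_set P' (Suc i)" "m i < x"
        "x < m (Suc i)" "P' (i, c i) = Some x" "\<alpha> i"
    | "\<not> (\<alpha> (Suc i) \<and> m (Suc i) \<notin> row_set P i)" "P' (i, c i) = P (i, c i)" "\<not> \<alpha> i"
    using step[OF assms(1) True] unfolding row_step_def mem by auto
  then show ?thesis
  proof cases
    case 1
    then show ?thesis using True path[OF assms(1,2)] by (intro D) auto
  next
    case 2
    then show ?thesis using True by (intro DR)
  next
    case (3 x)
    then show ?thesis using True by (intro IR[of x]) auto
  next
    case 4
    then show ?thesis using path[OF assms(1,2)] by (intro NR) auto
  qed
next
  case False
  then have iR: "i = R" "\<not> del" using assms by auto
  consider "m R + 1 \<in> row_set P R" "P' (R, C) = P (R, C)" "\<not> \<alpha> R"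
    | x where "x \<in> row_set P' (Suc R)" "m R < x" "P' (R, C) = Some x" "\<alpha> R"
    | "P' (R, C) = P (R, C)" "\<not> \<alpha> R"
    using last_step[OF iR(2)] unfolding row_step_def by auto
  then show ?thesis
  proof cases
    case 1
    then show ?thesis using iR cR path[OF assms(1,2)] by (intro D) auto
  next
    case (2 x)
    then show ?thesis using iR cR by (intro IR[of x]) auto
  next
    case 3
    then show ?thesis using iR cR path[OF assms(1,2)] by (intro NR) auto
  qed
qed

text \<open>By \<open>path_max\<close> the entries to the right of the path are at least
  \<open>m (Suc i)\<close>. The new value is smaller in (IR); in (DR) it equals
  \<open>m (Suc i)\<close>, which is absent from the row. In row \<open>R\<close> there is no right
  neighbour.\<close>

lemma entry:
  assumes "1 \<le> i" "i \<le> R" "\<not> (del \<and> i = R)"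
  shows "\<exists>y. P' (i, c i) = Some y \<and> m i \<le> y \<and> (i < R \<longrightarrow> y \<le> m (Suc i)) \<and>
    (\<forall>w. P (i, Suc (c i)) = Some w \<longrightarrow> y < w)"
proof -
  have next_less: "m i < w" if "P (i, Suc (c i)) = Some w" for w
    using increasing_row_less[OF inc path[OF assms(1,2)] that] by simp
  have next_ge: "m (Suc i) \<le> w" if "P (i, Suc (c i)) = Some w" "i < R" for w
    using path_max[OF assms(1) that(2,1)] by simp
  have no_next: "i < R" if "P (i, Suc (c i)) = Some w" for w
    using that outer cR assms by (cases "i = R") auto
  have m_le: "m i \<le> m (Suc i)" if "i < R" using m_less[OF assms(1) that] by simp
  from assms show ?thesis
  proof (cases rule: row_cases)
    case D
    then show ?thesis using next_less m_le by blast
  next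
    case DR
    have "m (Suc i) < w" if "P (i, Suc (c i)) = Some w" for w
      using next_ge[OF that DR(1)] that DR(3) by (auto simp: row_set_def le_less)
    then show ?thesis using DR m_le by blast
  next
    case (IR x)
    have "x < w" if "P (i, Suc (c i)) = Some w" for w
      using next_ge[OF that] no_next[OF that] IR(4) by simp
    then show ?thesis using IR by (intro exI[of _ x]) auto
  next
    case NR
    then show ?thesis using next_less m_le by blast
  qed
qed

lemma changed_on_path: "P' (i, j) \<noteq> P (i, j) \<Longrightarrow> 1 \<le> i \<and> i \<le> R \<and> j = c i"
  using off_path by blast

lemma changed_\<alpha>:
  assumes "1 \<le> i" "i \<le> R" "P' (i, c i) \<noteq> Some (m i)"
  shows "\<alpha> i"
proof (cases "del \<and> i = R")
  case True
  then show ?thesis using last_del by simp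
next
  case False
  with assms(1,2) show ?thesis
    by (cases rule: row_cases) (use assms(3) in auto)
qed

text \<open>A new value comes from the row below. In (IR) it is an unchanged entry strictly to the
  left, which gives the bypass. In (DR) it is the path entry \<open>m (Suc i)\<close>, either also
  to the left or in the same column, and then it must itself have been replaced.\<close>

lemma exchange_left_exit:
  assumes y: "P' (i, d) = Some y" "P (i, d) \<noteq> Some y"
  shows "2 \<le> d \<and> (\<forall>w. P (Suc i, d - 1) = Some w \<longrightarrow> y \<le> w) \<or>
      P (Suc i, d) = Some y \<and> P' (Suc i, d) \<noteq> Some y"
proof -
  have i: "1 \<le> i" "i \<le> R" and d: "d = c i" using changed_on_path[of i d] y by auto
  have nd: "\<not> (del \<and> i = R)" using y d cR last_del by auto
  have left: ?thesis if e: "P (Suc i, e) = Some y" "e < d" for e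
  proof -
    have "1 \<le> e" using increasing_index_pos[OF inc e(1)] by simp
    then have "2 \<le> d" using e by simp
    moreover have "y \<le> w" if "P (Suc i, d - 1) = Some w" for w
      using increasing_row_le[OF inc e(1) that] e by simp
    ultimately show ?thesis by blast
  qed
  from i nd show ?thesis
  proof (cases rule: row_cases)
    case DR
    have i': "1 \<le> Suc i" "Suc i \<le> R" using DR by auto
    have y_eq: "y = m (Suc i)" using DR y d by simp
    have next_cell: "P (Suc i, c (Suc i)) = Some y" using path[OF i'] y_eq by simp
    show ?thesis
    proof (cases "c (Suc i) = d")
      case False
      then show ?thesis using left[OF next_cell] c_le[OF i(1) DR(1)] d by simp
    next
      case True
      have "P' (Suc i, d) \<noteq> Some y"
      proof
        assume eq: "P' (Suc i, d) = Some y"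
        have "\<not> (del \<and> Suc i = R)" using eq last_del True cR by auto
        from i' this show False
        proof (cases rule: row_cases)
          case D
          \<comment> \<open>An entry at most \<open>Suc y\<close> just right of the path in row
            \<open>Suc i\<close> forces the entry above it to be \<open>y\<close>, but (DR) in row
            \<open>i\<close> requires \<open>y\<close> to be absent from that row.\<close>
          obtain w where w: "P (Suc i, Suc d) = Some w" "w \<le> Suc y"
            using row_succ_beyond[OF i' D(1)] True y_eq by auto
          obtain v where v: "P (i, Suc d) = Some v"
            using increasing_cell[OF inc w(1), of i "Suc d"] i by auto
          have "v < w" using increasing_col_less[OF inc v w(1)] by simp
          moreover have "y \<le> v" using path_max[OF i(1) DR(1) v] d y_eq by simp
          ultimately have "v = y" using w by simp
          then show False using v DR(3) y_eq by (auto simp: row_set_def)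
        next
          case DR': DR
          then show False using eq True m_less[of "Suc i"] y_eq by simp
        next
          case (IR x)
          then show False using eq True y_eq by simp
        next
          case NR
          then show False using DR by simp
        qed
      qed
      then show ?thesis using next_cell True by simp
    qed
  next
    case (IR x)
    have xy: "x = y" using IR y d by simp
    obtain e where e: "P' (Suc i, e) = Some x" using IR(2) by (auto simp: row_set_def)
    show ?thesis
    proof (cases "i < R")
      case True
      have i': "1 \<le> Suc i" "Suc i \<le> R" using True by auto
      \<comment> \<open>The path cell below cannot supply \<open>x\<close>, since by
        \<open>entry\<close> its new value is at least \<open>m (Suc i)\<close>.\<close>
      have "e \<noteq> c (Suc i)"
      proof
        assume eq: "e = c (Suc i)"
        have "\<not> (del \<and> Suc i = R)" using eq e last_del cR by auto
        from entry[OF i' this] show False using e eq IR(4) True by auto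
      qed
      then have Pe: "P (Suc i, e) = Some x" using off_path[of "Suc i" e] e by simp
      then have "e < c (Suc i)" using increasing_row_less_iff[OF inc Pe path[OF i']] IR(4) True by simp
      then show ?thesis using left[of e] Pe xy c_le[OF i(1) True] d by simp
    next
      case False
      then have "i = R" using i by simp
      \<comment> \<open>For \<open>i = R\<close> the value comes from row \<open>Suc R\<close>,
        which ends to the left of column \<open>C\<close> because the cell is outer.\<close>
      then have Pe: "P (Suc R, e) = Some x" using off_path[of "Suc R" e] e by simp
      have "e < d"
      proof (rule ccontr)
        assume "\<not> e < d"
        moreover have "1 \<le> d" using increasing_index_pos[OF inc path[OF i]] d by simp
        ultimately have "\<exists>b. P (Suc R, d) = Some b" using increasing_cell[OF inc Pe, of "Suc R" d] by simp
        then show False using outer d cR \<open>i = R\<close> by simp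
      qed
      then show ?thesis using left[of e] Pe xy \<open>i = R\<close> by simp
    qed
  qed (use y d path[OF i] in auto)
qed

text \<open>Losing \<open>m i\<close> means that \<open>\<alpha> i\<close> holds. If the path moves
  right in the row above, that row has an entry at most \<open>m (i - 1)\<close> in column
  \<open>Suc d\<close>. Otherwise (DR) moves \<open>m i\<close> up, and every other case provides an
  entry of the row above in the interval from \<open>m (i - 1) + 1\<close> to \<open>m i\<close>,
  which bounds the right neighbour of the path cell.\<close>

lemma exchange_right_exit:
  assumes m': "P (i, d) = Some m'" "P' (i, d) \<noteq> Some m'"
  shows "i = 1 \<or> (\<exists>w\<le>m'. P (i - 1, Suc d) = Some w) \<or> P' (i - 1, d) = Some m'"
proof (cases "i = 1")
  case False
  have i: "1 \<le> i" "i \<le> R" and d: "d = c i" using changed_on_path[of i d] m' by auto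
  then obtain k where k: "i = Suc k" "1 \<le> k" "k < R" using False by (cases i) auto
  have m'_eq: "m' = m i" using path[OF i] m' d by simp
  have \<alpha>i: "\<alpha> i" using changed_\<alpha>[OF i] m' d m'_eq by simp
  have less: "m k < m'" using m_less[OF k(2,3)] k m'_eq by simp
  have k': "1 \<le> k" "k \<le> R" "\<not> (del \<and> k = R)" using k by auto
  show ?thesis
  proof (cases "c k = d")
    case False
    then have "d < c k" using c_le[OF k(2,3)] k d by simp
    then obtain w where w: "P (k, Suc d) = Some w"
      using increasing_cell[OF inc path[OF k'(1,2)], of k "Suc d"] k by auto
    have "w \<le> m k" using increasing_row_le[OF inc w path[OF k'(1,2)]] \<open>d < c k\<close> by simp
    then show ?thesis using w less k by auto
  next
    case True
    have beyond: ?thesis if v: "v \<in> row_set P k" "m k < v" "v \<le> m'" for v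
      using row_succ_beyond[OF k'(1,2) v(1,2)] v(3) True k by force
    from k' show ?thesis
    proof (cases rule: row_cases)
      case D
      then show ?thesis using beyond[of "m k + 1"] less by simp
    next
      case DR
      then show ?thesis using True k m'_eq by simp
    next
      case (IR x)
      then show ?thesis using beyond[of m'] less \<alpha>i m'_eq k by simp
    next
      case NR
      then show ?thesis using beyond[of m'] less \<alpha>i m'_eq k by simp
    qed
  qed
qed simp

sublocale tableau_exchange P P'
proof
  show "increasing_tableau P" by (rule inc)
next
  fix i d w assume w: "P' (i, d) = Some w"
  show "\<exists>v\<le>w. P (i, d) = Some v"
  proof (cases "1 \<le> i \<and> i \<le> R \<and> d = c i")
    case True
    then have "\<not> (del \<and> i = R)" using w cR last_del by auto
    then obtain y where "P' (i, c i) = Some y" "m i \<le> y" using entry[of i] True by blast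
    then show ?thesis using path[of i] w True by auto
  next
    case False
    then show ?thesis using off_path[OF False] w by auto
  qed
next
  fix i i' d w assume i: "1 \<le> i" "i < i'" and w: "P (i', d) = Some w"
  have d1: "1 \<le> d" using increasing_index_pos[OF inc w] by simp
  show "\<exists>y\<le>w. P' (i, d) = Some y"
  proof (cases "1 \<le> i \<and> i \<le> R \<and> d = c i")
    case True
    have iR: "i < R"
    proof (rule ccontr)
      assume "\<not> i < R"
      then have "i = R" "d = C" using True cR by auto
      then show False using increasing_cell[OF inc w, of "Suc R" C] i d1 outer by auto
    qed
    obtain y where y: "P' (i, c i) = Some y" "y \<le> m (Suc i)" using entry[of i] i iR by auto
    obtain v where v: "P (Suc i, d) = Some v" using increasing_cell[OF inc w, of "Suc i" d] i d1 by auto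
    \<comment> \<open>The path moves weakly left on the way down, so \<open>m (Suc i)\<close> stands
      weakly to the left of \<open>v\<close> in row \<open>Suc i\<close>.\<close>
    have "m (Suc i) \<le> v"
      using increasing_row_le[OF inc path[of "Suc i"] v] iR c_le[OF i(1) iR] True by simp
    also have "v \<le> w" using increasing_col_le[OF inc v w] i by simp
    finally show ?thesis using y True by auto
  next
    case False
    obtain v where v: "P (i, d) = Some v" using increasing_cell[OF inc w, of i d] i d1 by auto
    then have "v < w" using increasing_col_less[OF inc v w] i by simp
    then show ?thesis using off_path[OF False] v by auto
  qed
next
  fix d i w assume d: "1 \<le> d" and w: "P (i, Suc d) = Some w"
  have i1: "1 \<le> i" using increasing_index_pos[OF inc w] by simp
  show "\<exists>y<w. P' (i, d) = Some y"
  proof (cases "1 \<le> i \<and> i \<le> R \<and> d = c i")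
    case True
    then have "\<not> (del \<and> i = R)" using w cR outer by auto
    then obtain y where "P' (i, c i) = Some y" "\<And>v. P (i, Suc (c i)) = Some v \<Longrightarrow> y < v"
      using entry[of i] True by blast
    then show ?thesis using w True by auto
  next
    case False
    obtain v where v: "P (i, d) = Some v" using increasing_cell[OF inc w, of i d] i1 d by auto
    then have "v < w" using increasing_row_less[OF inc v w] by simp
    then show ?thesis using off_path[OF False] v by auto
  qed
next
  fix i d i' d' assume ch: "P' (i, d) \<noteq> P (i, d)" "P' (i', d') \<noteq> P (i', d')" "d' < d"
  have i: "1 \<le> i" "i \<le> R" "d = c i" and i': "1 \<le> i'" "i' \<le> R" "d' = c i'"
    using changed_on_path ch by auto
  have lt: "i < i'" using c_antimono[of i' i] i i' ch(3) by (metis leD leI)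
  then have iR: "i < R" using i' by simp
  obtain y where y: "P' (i, c i) = Some y" "y \<le> m (Suc i)" using entry[of i] i iR by auto
  moreover have "m (Suc i) \<le> m i'" using m_mono[of "Suc i" i'] lt i' by simp
  ultimately show "i < i' \<and> (\<exists>y m. P' (i, d) = Some y \<and> P (i', d') = Some m \<and> y \<le> m)"
    using lt path[OF i'(1,2)] i i' by auto
qed (fact exchange_left_exit exchange_right_exit)+

lemma kept: "P (i, d) \<noteq> None \<Longrightarrow> \<not> (del \<and> (i, d) = (R, C)) \<Longrightarrow> P' (i, d) \<noteq> None"
proof (cases "1 \<le> i \<and> i \<le> R \<and> d = c i")
  case True
  assume "\<not> (del \<and> (i, d) = (R, C))"
  with True cR have "\<not> (del \<and> i = R)" by auto
  then show ?thesis using entry[of i] True by auto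
next
  case False
  assume "P (i, d) \<noteq> None"
  then show ?thesis using off_path[OF False] by simp
qed

end

section \<open>The bumping path and the conclusion\<close>

lemma bcol_Suc:
  assumes P: "increasing_tableau P" and a: "P (r - k, bcol P r c k) = Some a" and k: "Suc k < r"
  shows "\<exists>v. P (r - Suc k, bcol P r c (Suc k)) = Some v \<and> v < a \<and> bcol P r c k \<le> bcol P r c (Suc k) \<and>
    (\<forall>j w. P (r - Suc k, j) = Some w \<and> bcol P r c (Suc k) < j \<longrightarrow> a \<le> w)"
proof -
  define ok where "ok j \<longleftrightarrow> (\<exists>v. P (r - Suc k, j) = Some v \<and> v < a)" for j
  have def: "bcol P r c (Suc k) = (GREATEST j. ok j)" using a by (simp add: ok_def)
  have bound: "\<forall>j. ok j \<longrightarrow> j \<le> Max (snd ` dom P)"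
  proof (intro allI impI)
    fix j assume "ok j"
    then have "j \<in> snd ` dom P" by (force simp: ok_def)
    then show "j \<le> Max (snd ` dom P)" using increasing_finite[OF P] by simp
  qed
  \<comment> \<open>The cell directly above has a smaller entry. It shows that
    \<open>GREATEST\<close> ranges over a nonempty set and that the columns of the path increase
    weakly on the way up.\<close>
  have "1 \<le> r - Suc k" "r - Suc k \<le> r - k" using k by auto
  then obtain b where b: "P (r - Suc k, bcol P r c k) = Some b"
    using increasing_cell[OF P a, of "r - Suc k" "bcol P r c k"] increasing_index_pos[OF P a] by auto
  moreover have "b < a" using increasing_col_less[OF P b a] k by simp
  ultimately have ok: "ok (bcol P r c k)" by (simp add: ok_def)
  have 1: "ok (bcol P r c (Suc k))" unfolding def using ok bound by (blast intro: GreatestI_nat)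
  have 2: "j \<le> bcol P r c (Suc k)" if "ok j" for j
    unfolding def using that bound by (blast intro: Greatest_le_nat)
  have "a \<le> w" if "P (r - Suc k, j) = Some w" "bcol P r c (Suc k) < j" for j w
  proof (rule ccontr)
    assume "\<not> a \<le> w"
    then have "ok j" using that by (simp add: ok_def)
    then show False using 2 that(2) by (meson leD)
  qed
  then show ?thesis using 1 2[OF ok] unfolding ok_def by blast
qed

lemma bcol_cell:
  assumes P: "increasing_tableau P" "P (r, c) = Some a"
  shows "k < r \<Longrightarrow> \<exists>v. P (r - k, bcol P r c k) = Some v"
proof (induction k)
  case 0
  then show ?case using P by simp
next
  case (Suc k)
  then show ?case using bcol_Suc[OF P(1), of r k c] by auto
qed

lemma reverse_bumping_rri:
  assumes P: "increasing_tableau P" and out: "outer_cell P (R, C)"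
    and off: "\<And>i j. \<not> (1 \<le> i \<and> i \<le> R \<and> j = bcol P R C (R - i)) \<Longrightarrow> P' (i, j) = P (i, j)"
    and step: "\<And>i. 1 \<le> i \<Longrightarrow> i < R \<Longrightarrow> row_step P P' i (bcol P R C (R - i)) (bm P R C i)
       (enat (bm P R C (Suc i))) (\<alpha> (Suc i)) (\<alpha> i)"
    and del: "del \<Longrightarrow> P' (R, C) = None \<and> \<alpha> R"
    and nodel: "\<not> del \<Longrightarrow> row_step P P' R C (bm P R C R) \<infinity> False (\<alpha> R)"
  shows "reverse_bumping P P' R C (\<lambda>i. bcol P R C (R - i)) (bm P R C) \<alpha> del"
proof -
  obtain a where a: "P (R, C) = Some a" and out': "P (Suc R, C) = None" "P (R, Suc C) = None"
    using out by (auto simp: outer_cell_def)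
  have path: "P (i, bcol P R C (R - i)) = Some (bm P R C i)" if "1 \<le> i" "i \<le> R" for i
    using bcol_cell[OF P a, of "R - i"] that by (auto simp: bm_def)
  have next_row: "bm P R C i < bm P R C (Suc i) \<and> bcol P R C (R - Suc i) \<le> bcol P R C (R - i) \<and>
      (\<forall>j w. P (i, j) = Some w \<and> bcol P R C (R - i) < j \<longrightarrow> bm P R C (Suc i) \<le> w)"
    if i: "1 \<le> i" "i < R" for i
  proof -
    \<comment> \<open>\<open>bcol\<close> counts steps upwards from row \<open>R\<close>, so row
      \<open>i\<close> is step \<open>R - i\<close>; these equations translate between the two
      indexings.\<close>
    have 1: "R - i = Suc (R - Suc i)" "R - (R - Suc i) = Suc i" "R - Suc (R - Suc i) = i" using i by auto
    have "P (R - (R - Suc i), bcol P R C (R - Suc i)) = Some (bm P R C (Suc i))"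
      using path[of "Suc i"] i 1 by simp
    from bcol_Suc[OF P this] obtain v where v: "P (i, bcol P R C (R - i)) = Some v" "v < bm P R C (Suc i)"
      "bcol P R C (R - Suc i) \<le> bcol P R C (R - i)"
      "\<forall>j w. P (i, j) = Some w \<and> bcol P R C (R - i) < j \<longrightarrow> bm P R C (Suc i) \<le> w"
      unfolding 1(3) unfolding 1(1)[symmetric] using i by auto
    moreover have "v = bm P R C i" using path[of i] v i by simp
    ultimately show ?thesis by blast
  qed
  show ?thesis
  proof
    show "1 \<le> R" using increasing_index_pos[OF P a] by simp
  qed (use P out' path next_row off step del nodel in auto)
qed

theorem theorem6p8:
  fixes P P' :: tableau and R C \<alpha> m :: nat
  assumes "increasing_tableau P"
    and "outer_cell P (R, C)"
    and "\<alpha> \<in> {0, 1}"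
    and "reverse_row_insertion P (R, C) \<alpha> = (P', m)"
  shows "(\<alpha> = 0 \<longrightarrow> left_key P = left_key P') \<and>
         (\<alpha> = 1 \<longrightarrow>
            (\<forall>j. j \<noteq> C \<longrightarrow> col_set (left_key P') j = col_set (left_key P) j) \<and>
            col_set (left_key P') C =
              col_set (left_key P) C -
                {Min (col_set (left_key P) C - col_set (left_key P) (C + 1))})"
proof -
  note P = assms(1)
  note fin = increasing_finite[OF P]
  obtain a where a: "P (R, C) = Some a" and out: "P (Suc R, C) = None" "P (R, Suc C) = None"
    using assms(2) by (auto simp: outer_cell_def)
  have pos: "1 \<le> R" "1 \<le> C" using increasing_index_pos[OF P a] by auto
  let ?c = "\<lambda>i. bcol P R C (R - i)" and ?m = "bm P R C"
  show ?thesis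
  proof (intro conjI impI)
    assume "\<alpha> = 0"
    then obtain a' where loop: "rri_loop P R C R (P, False) = (P', a')"
      using assms(4) by (cases "rri_loop P R C R (P, False)") (auto simp: reverse_row_insertion_def)
    obtain \<beta> where \<beta>: "\<beta> (Suc R) = False"
      "\<And>i j. \<not> (1 \<le> i \<and> i \<le> R \<and> j = ?c i) \<Longrightarrow> P' (i, j) = P (i, j)"
      "\<And>i. 1 \<le> i \<Longrightarrow> i \<le> R \<Longrightarrow> row_step P P' i (?c i) (?m i)
         (if i = R then \<infinity> else enat (?m (Suc i))) (\<beta> (Suc i)) (\<beta> i)"
      using rri_loop_row_step[OF order_refl fin _ loop] by auto
    have steps: "row_step P P' i (?c i) (?m i) (enat (?m (Suc i))) (\<beta> (Suc i)) (\<beta> i)"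
      if "1 \<le> i" "i < R" for i using \<beta>(3)[of i] that by simp
    have last: "row_step P P' R C (?m R) \<infinity> False (\<beta> R)" using \<beta>(3)[of R] \<beta>(1) pos by simp
    interpret reverse_bumping P P' R C ?c ?m \<beta> False
      by (rule reverse_bumping_rri[OF P assms(2) \<beta>(2) steps _ last]) auto
    have "dom P' = dom P"
      using dom_subset kept by (auto simp: dom_def)
    moreover have "key_col P' c = key_col P c" if "1 \<le> c" for c
      using that kept by (intro key_col_eq) auto
    moreover have "1 \<le> c" if "(r, c) \<in> dom P" for r c
      using that increasing_index_pos[OF P] by auto
    ultimately show "left_key P = left_key P'"
      by (auto simp: left_key_def fun_eq_iff)
  next
    assume "\<alpha> = 1"
    define Q where "Q = P((R, C) := None)"
    obtain a' where loop: "rri_loop P R C (R - 1) (Q, True) = (P', a')"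
      using assms(4) \<open>\<alpha> = 1\<close> unfolding Q_def
      by (cases "rri_loop P R C (R - 1) (P((R, C) := None), True)") (auto simp: reverse_row_insertion_def)
    have Q: "finite (dom Q)" "\<And>i j. i \<le> R - 1 \<Longrightarrow> Q (i, j) = P (i, j)"
      using fin pos by (auto simp: Q_def)
    obtain \<beta> where \<beta>: "\<beta> R = True"
      "\<And>i j. \<not> (1 \<le> i \<and> i \<le> R - 1 \<and> j = ?c i) \<Longrightarrow> P' (i, j) = Q (i, j)"
      "\<And>i. 1 \<le> i \<Longrightarrow> i \<le> R - 1 \<Longrightarrow> row_step P P' i (?c i) (?m i)
         (if i = R then \<infinity> else enat (?m (Suc i))) (\<beta> (Suc i)) (\<beta> i)"
      using rri_loop_row_step[OF _ Q loop] pos by auto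
    have steps: "row_step P P' i (?c i) (?m i) (enat (?m (Suc i))) (\<beta> (Suc i)) (\<beta> i)"
      if "1 \<le> i" "i < R" for i using \<beta>(3)[of i] that by simp
    have off: "P' (i, j) = P (i, j)" if ij: "\<not> (1 \<le> i \<and> i \<le> R \<and> j = ?c i)" for i j
    proof -
      have "(i, j) \<noteq> (R, C)" using ij pos by auto
      moreover have "P' (i, j) = Q (i, j)" using ij by (intro \<beta>(2)) auto
      ultimately show ?thesis by (auto simp: Q_def)
    qed
    have last: "P' (R, C) = None \<and> \<beta> R" using \<beta>(1) \<beta>(2)[of R C] pos by (simp add: Q_def)
    interpret reverse_bumping P P' R C ?c ?m \<beta> True
      by (rule reverse_bumping_rri[OF P assms(2) off steps last]) auto
    have keyP: "col_set (left_key P) j = key_col P j" if "1 \<le> j" for j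
      using fin increasing_rows_in_UNIV[OF P] card_key_col[OF P that] by (intro col_set_left_key) auto
    have colC: "key_col P' C = key_col P C - {Min (key_col P C - key_col P (Suc C))}"
      and rowsC: "rows_in P' C UNIV = {1..card (key_col P' C)}"
      using a out last kept by (intro key_col_deleted[of R C]; auto)+
    have other: "key_col P' j = key_col P j" if "1 \<le> j" "j \<noteq> C" for j
      using that kept by (intro key_col_eq) auto
    have domP': "P' (i, d) \<noteq> None \<longleftrightarrow> P (i, d) \<noteq> None \<and> (i, d) \<noteq> (R, C)" for i d
      using kept[of i d] last dom_subset by (auto simp: dom_def)
    show "\<forall>j. j \<noteq> C \<longrightarrow> col_set (left_key P') j = col_set (left_key P) j"
    proof (intro allI impI)
      fix j assume j: "j \<noteq> C"
      show "col_set (left_key P') j = col_set (left_key P) j"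
      \<comment> \<open>By truncated subtraction \<open>key_col\<close> at 0 equals
        \<open>key_col\<close> at 1, although the tableaux have no column 0; this column is settled
        by emptiness.\<close>
      proof (cases "j = 0")
        case True
        have "P (i, 0) = None" for i using increasing_index_pos[OF P, of i 0] by fastforce
        moreover from this have "P' (i, 0) = None" for i using domP'[of i 0] by simp
        ultimately show ?thesis using True by (simp add: col_set_def left_key_def dom_def)
      next
        case False
        then have j1: "1 \<le> j" by simp
        have "rows_in P' j UNIV = rows_in P j UNIV"
          unfolding rows_in_UNIV using j by (auto simp: domP' simp del: not_None_eq)
        then have "rows_in P' j UNIV = {1..card (key_col P' j)}"
          using increasing_rows_in_UNIV[OF P] card_key_col[OF P j1] other[OF j1 j] by simp
        then show ?thesis using col_set_left_key[OF fin'] keyP[OF j1] other[OF j1 j] by simp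
      qed
    qed
    have "col_set (left_key P') C = key_col P' C"
      using rowsC by (rule col_set_left_key[OF fin'])
    then show "col_set (left_key P') C = col_set (left_key P) C -
        {Min (col_set (left_key P) C - col_set (left_key P) (C + 1))}"
      using colC keyP pos by simp
  qed
qed

end
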